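(* Suppose that the Bayesian game described in the context satisfies: (a) Assumptions A, B, C and E stated there; (b) there exists a vector $w=(w_1,\dots,w_n)$ with $w_i>0$ for all $i$ such that $\alpha:=\|D^{-1}MD\|_\infty<1$, where $D=\mathrm{diag}(w)$, $M=[M_{ij}]_{i,j=1}^n$ with $M_{ii}:=0$, $M_{ij}:=\tau_{ij}/\sigma_i$ for $i\ne j$, and $\|\cdot\|_\infty$ is the matrix infinity norm (maximum absolute row sum). Let $f^*_\eta$ be the continuous Bayesian Nash equilibrium under the true distribution $\eta$ and let $f^*_\mu$ be the unique Bayesian Nash equilibrium under a perturbed distribution $\mu\in\mathcal M(\Theta)$. Then $$\max_{i\in N}\left(\frac1{w_i}\sup_{\theta_i\in\Theta_i}\|f^*_{i,\eta}(\theta_i)-f^*_{i,\mu}(\theta_i)\|\right)\le\max_{i\in N}\sup_{\theta_i\in\Theta_i}\frac{\tau_i+\varrho_i}{w_i\sigma_i(1-\alpha)}\,\mathsf d_{\mathrm K}\big(\eta_i(\cdot\mid\theta_i),\mu_i(\cdot\mid\theta_i)\big),$$ where $\tau_i:=\Big(\sum_{j\ne i}\tau_{ij}^2\big(\tfrac{\kappa_j}{\sigma_j}\big)^2\Big)^{1/2}$ and $\kappa_j:=\overline\nu_j+2\gamma_j\sup_{a\in\mathcal A,\theta\in\Theta}\|\nabla_{a_j}u_j(a,\theta)\|$.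
   Context: Bayesian game. $N=\{1,\dots,n\}$ is the set of players. For $i\in N$, the type set $\Theta_i\subset\mathbb R^{d_i}$ and the action set $\mathcal A_i\subset\mathbb R^{z_i}$ are non-empty, compact and convex. $\Theta=\prod_i\Theta_i$, $\mathcal A=\prod_i\mathcal A_i$, and the subscript $-i$ denotes the product/vector over all players except $i$. Player $i$'s utility is $u_i(a_i,a_{-i},\theta)$, $a=(a_i,a_{-i})\in\mathcal A$, $\theta=(\theta_i,\theta_{-i})\in\Theta$. The true distribution of the type profile $\theta$ is $\eta$, a Borel probability measure on $\Theta$ with full support. For a Borel probability measure $\mu$ on $\Theta$ (in particular for $\eta$), $\mu_i$ denotes its marginal on $\Theta_i$, and $\mu_i(\cdot\mid\theta_i)$ the conditional distribution of $\theta_{-i}$ given $\theta_i$, a probability measure on $\Theta_{-i}$ specified for every $\theta_i\in\Theta_i$. $\mathcal M(\Theta)$ is the set of Borel probability measures $\mu$ on $\Theta$ such that, for every $i\in N$ and every Borel $S\subset\Theta_{-i}$, $\mu_i(S\mid\theta_i)$ is measurable in $\theta_i$. Norms of vectors are Euclidean. Strategies. $\mathcal F_i$ is the set of measurable functions $f_i:\Theta_i\to\mathcal A_i$; $\mathcal F=\prod_i\mathcal F_i$, $\mathcal F_{-i}=\prod_{j\neq i}\mathcal F_j$. For a distribution $\mu$ the expected utility is $\phi_{i,\mu}(a_i,f_{-i},\theta_i)=\int_{\Theta_{-i}}u_i(a_i,f_{-i}(\theta_{-i}),\theta_i,\theta_{-i})\,d\mu_i(\theta_{-i}\mid\theta_i)$.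 A Bayesian Nash equilibrium (BNE) under $\mu$ is an $f^*_\mu=(f^*_{1,\mu},\dots,f^*_{n,\mu})\in\mathcal F$ with $f_{i,\mu}^*(\theta_i)\in\arg\max_{a_i\in\mathcal A_i}\phi_{i,\mu}(a_i,f^*_{-i,\mu},\theta_i)$ for all $\theta_i\in\Theta_i$ and all $i\in N$; it is continuous if each component is continuous. (Under (a) and (b) the BNE exists and is unique pointwise under $\eta$, where it is continuous, and under every $\mu\in\mathcal M(\Theta)$.) Assumption A. For each $i\in N$: (a) $u_i(a,\theta)$ is continuous in $(a,\theta)$, and $\nabla_{a_i}u_i(a,\theta)$ is continuous in $a$ and measurable in $\theta$; (b) for each $\hat a_i\in\mathcal A_i$, $f_{-i}\in\mathcal F_{-i}$ and $\theta_i\in\Theta_i$ there exist a neighborhood $\mathcal U_i(\hat a_i;f_{-i},\theta_i)$ of $\hat a_i$ relative to $\mathcal A_i$ and a nonnegative function $h_{\hat a_i,f_{-i}}:\Theta_i\times\Theta_{-i}\to\mathbb R_+$ with $h_{\hat a_i,f_{-i}}(\theta_i,\cdot)\in\mathcal L^1(\eta_i(\cdot\mid\theta_i))$ such that $\sup_{a_i\in\mathcal U_i(\hat a_i;f_{-i},\theta_i)}\|\nabla_{a_i}u_i(a_i,f_{-i}(\theta_{-i}),\theta_i,\theta_{-i})\|\le h_{\hat a_i,f_{-i}}(\theta_i,\theta_{-i})$ for all $\theta_{-i}\in\Theta_{-i}$ (the function $h_{\hat a_i,f_{-i}}$ depends only on $\hat a_i,f_{-i}$, the neighborhood may depend on $\theta_i$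 too); (c) for every Borel set $S\subset\Theta_{-i}$, $\eta_i(S\mid\cdot)$ is measurable on $\Theta_i$. Assumption B. For each $i\in N$: (a) there is a constant $\sigma_i>0$ such that $(\nabla_{a_i}u_i(a_i',a_{-i},\theta)-\nabla_{a_i}u_i(a_i'',a_{-i},\theta))^\top(a_i'-a_i'')\le-\sigma_i\|a_i'-a_i''\|^2$ for all $a_i',a_i''\in\mathcal A_i$, $a_{-i}\in\mathcal A_{-i}$, $\theta\in\Theta$; (b) there are constants $\tau_{ij}\ge 0$, $j\ne i$, such that $\|\nabla_{a_i}u_i(a_i,a_{-i}',\theta)-\nabla_{a_i}u_i(a_i,a_{-i}'',\theta)\|\le\sum_{j\ne i}\tau_{ij}\|a_j'-a_j''\|$ for all $a_{-i}',a_{-i}''\in\mathcal A_{-i}$, $a_i\in\mathcal A_i$, $\theta\in\Theta$. Assumption C. For each $i\in N$: (a) $\sup_{a\in\mathcal A,\theta\in\Theta}\|\nabla_{a_i}u_i(a,\theta)\|<+\infty$; (b) there is a nonnegative measurable function $\nu_i:\Theta_{-i}\to\mathbb R_+$ such that $\|\nabla_{a_i}u_i(a,\theta_i',\theta_{-i})-\nabla_{a_i}u_i(a,\theta_i'',\theta_{-i})\|\le\nu_i(\theta_{-i})\|\theta_i'-\theta_i''\|$ for all $a\in\mathcal A$, $\theta_i',\theta_i''\in\Theta_i$, $\theta_{-i}\in\Theta_{-i}$, and $\overline\nu_i:=\sup_{\theta_i\in\Theta_i}\int_{\Theta_{-i}}\nu_i(\theta_{-i})\,d\eta_i(\theta_{-i}\mid\theta_i)<+\infty$;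 (c) there is $\gamma_i>0$ with $\mathsf d_{\mathrm{TV}}(\eta_i(\cdot\mid\theta_i'),\eta_i(\cdot\mid\theta_i''))\le\gamma_i\|\theta_i'-\theta_i''\|$ for all $\theta_i',\theta_i''\in\Theta_i$, where $\mathsf d_{\mathrm{TV}}(\mu,\nu)=\frac12\sup\{|\int h\,d\mu-\int h\,d\nu|: h\text{ measurable real-valued},\ \|h\|_\infty\le1\}$. Assumption E. For each $i\in N$ there is a constant $\varrho_i$ such that $\|\nabla_{a_i}u_i(a_i,a_{-i},\theta_i,\theta_{-i}')-\nabla_{a_i}u_i(a_i,a_{-i},\theta_i,\theta_{-i}'')\|\le\varrho_i\|\theta_{-i}'-\theta_{-i}''\|$ for all $\theta_{-i}',\theta_{-i}''\in\Theta_{-i}$, $a\in\mathcal A$, $\theta_i\in\Theta_i$. Kantorovich (Wasserstein-1) distance: $\mathsf d_{\mathrm K}(\mu,\nu)=\sup\{|\int_\Xi h\,d\mu-\int_\Xi h\,d\nu|: h:\Xi\to\mathbb R,\ \mathrm{Lip}(h)\le1\}$ for probability measures $\mu,\nu$ on $\Xi$. *)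

theory Defs
  imports "HOL-Probability.Probability"
begin

text \<open>
  The players are the elements of a finite type \<open>'n\<close>. The dimensions of the players' type and action
  spaces may differ from player to player: each of these spaces is identified with a coordinate
  subspace of one Euclidean space (\<open>'t\<close> for types, \<open>'a\<close> for actions) that is large enough for all
  players. Nothing forces the sets \<open>T i\<close> and \<open>A i\<close> to be full-dimensional, and norms, compactness,
  convexity and Borel sets are not affected by the identification.

  A profile is a vector in \<open>'x ^ 'n\<close>, whose norm is the Euclidean norm of the concatenated components.
  A profile of all players except \<open>i\<close> is a vector in \<open>'x ^ 'n\<close> whose \<open>i\<close>-th component is set to \<open>0\<close>;
  its norm is then the Euclidean norm of the components of the other players.
\<close>

section \<open>Profiles\<close>

definition profiles :: "('n::finite \<Rightarrow> 'x::euclidean_space set) \<Rightarrow> ('x ^ 'n) set" where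
  "profiles X = {x. \<forall>i. x $ i \<in> X i}"

definition others :: "('n::finite \<Rightarrow> 'x::euclidean_space set) \<Rightarrow> 'n \<Rightarrow> ('x ^ 'n) set" where
  "others X i = {x. x $ i = 0 \<and> (\<forall>j. j \<noteq> i \<longrightarrow> x $ j \<in> X j)}"

definition drop_player :: "'n::finite \<Rightarrow> 'x::euclidean_space ^ 'n \<Rightarrow> 'x ^ 'n" where
  "drop_player i x = (\<chi> j. if j = i then 0 else x $ j)"

text \<open>\<open>join i v x\<close> is the profile $(v, x_{-i})$; the \<open>i\<close>-th component of \<open>x\<close> is irrelevant.\<close>

definition join :: "'n::finite \<Rightarrow> 'x::euclidean_space \<Rightarrow> 'x ^ 'n \<Rightarrow> 'x ^ 'n" where
  "join i v x = (\<chi> j. if j = i then v else x $ j)"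

definition borel_on :: "'x::topological_space set \<Rightarrow> 'x measure" where
  "borel_on X = restrict_space borel X"

section \<open>Distances between probability measures\<close>

text \<open>
  Both suprema are suprema of real sets. The set in \<open>d_TV\<close> is bounded for probability measures; the
  set in \<open>d_K\<close> is bounded if the space is bounded, as it is for compact type sets.
\<close>

definition d_TV :: "'x measure \<Rightarrow> 'x measure \<Rightarrow> real" where
  "d_TV \<mu> \<nu> = 1 / 2 * (SUP h \<in> {h \<in> borel_measurable \<mu>. \<forall>x \<in> space \<mu>. \<bar>h x\<bar> \<le> 1}.
     \<bar>(\<integral>x. h x \<partial>\<mu>) - (\<integral>x. h x \<partial>\<nu>)\<bar>)"

definition d_K :: "'x::metric_space measure \<Rightarrow> 'x measure \<Rightarrow> real" where
  "d_K \<mu> \<nu> = (SUP h \<in> {h. 1-lipschitz_on (space \<mu>) h}. \<bar>(\<integral>x. h x \<partial>\<mu>) - (\<integral>x. h x \<partial>\<nu>)\<bar>)"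

section \<open>Type distributions and their conditionals\<close>

definition type_distribution ::
    "('n::finite \<Rightarrow> 't::euclidean_space set) \<Rightarrow> ('t ^ 'n) measure \<Rightarrow> bool" where
  "type_distribution T \<mu> \<longleftrightarrow> prob_space \<mu> \<and> sets \<mu> = sets (borel_on (profiles T))"

definition full_support ::
    "('n::finite \<Rightarrow> 't::euclidean_space set) \<Rightarrow> ('t ^ 'n) measure \<Rightarrow> bool" where
  "full_support T \<mu> \<longleftrightarrow>
     (\<forall>U. open U \<longrightarrow> U \<inter> profiles T \<noteq> {} \<longrightarrow> 0 < emeasure \<mu> (U \<inter> profiles T))"

definition marginal ::
    "('n::finite \<Rightarrow> 't::euclidean_space set) \<Rightarrow> ('t ^ 'n) measure \<Rightarrow> 'n \<Rightarrow> 't measure" where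
  "marginal T \<mu> i = distr \<mu> (borel_on (T i)) (\<lambda>\<theta>. \<theta> $ i)"

text \<open>
  \<open>\<mu>c i t\<close> is a version of the conditional distribution of the types of the players other than \<open>i\<close>,
  given that player \<open>i\<close> has type \<open>t\<close>. A version is chosen for every \<open>t \<in> T i\<close>, and equilibria depend on
  this choice, so it is a parameter. Measurability in \<open>t\<close> is a separate condition (\<open>meas_conditional\<close>).
\<close>

definition conditional_distribution ::
    "('n::finite \<Rightarrow> 't::euclidean_space set) \<Rightarrow> ('t ^ 'n) measure \<Rightarrow> ('n \<Rightarrow> 't \<Rightarrow> ('t ^ 'n) measure) \<Rightarrow> bool"
  where
  "conditional_distribution T \<mu> \<mu>c \<longleftrightarrow> (\<forall>i.
     (\<forall>t \<in> T i. prob_space (\<mu>c i t) \<and> sets (\<mu>c i t) = sets (borel_on (others T i))) \<and>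
     (\<forall>B \<in> sets (borel_on (T i)). \<forall>S \<in> sets (borel_on (others T i)).
        emeasure \<mu> {\<theta> \<in> profiles T. \<theta> $ i \<in> B \<and> drop_player i \<theta> \<in> S}
          = (\<integral>\<^sup>+t\<in>B. emeasure (\<mu>c i t) S \<partial>marginal T \<mu> i)))"

definition meas_conditional ::
    "('n::finite \<Rightarrow> 't::euclidean_space set) \<Rightarrow> ('n \<Rightarrow> 't \<Rightarrow> ('t ^ 'n) measure) \<Rightarrow> 'n \<Rightarrow> bool" where
  "meas_conditional T \<mu>c i \<longleftrightarrow> (\<forall>S \<in> sets (borel_on (others T i)).
     (\<lambda>t. measure (\<mu>c i t) S) \<in> borel_measurable (borel_on (T i)))"

text \<open>The class $\mathcal M(\Theta)$, with the conditional distributions made explicit.\<close>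

definition admissible_distribution ::
    "('n::finite \<Rightarrow> 't::euclidean_space set) \<Rightarrow> ('t ^ 'n) measure \<Rightarrow> ('n \<Rightarrow> 't \<Rightarrow> ('t ^ 'n) measure) \<Rightarrow> bool"
  where
  "admissible_distribution T \<mu> \<mu>c \<longleftrightarrow>
     type_distribution T \<mu> \<and> conditional_distribution T \<mu> \<mu>c \<and> (\<forall>i. meas_conditional T \<mu>c i)"

section \<open>Games, strategies and equilibria\<close>

definition game_sets ::
    "('n::finite \<Rightarrow> 't::euclidean_space set) \<Rightarrow> ('n \<Rightarrow> 'a::euclidean_space set) \<Rightarrow> bool" where
  "game_sets T A \<longleftrightarrow>
     (\<forall>i. T i \<noteq> {} \<and> compact (T i) \<and> convex (T i) \<and> A i \<noteq> {} \<and> compact (A i) \<and> convex (A i))"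

definition strategies :: "'t::euclidean_space set \<Rightarrow> 'a::euclidean_space set \<Rightarrow> ('t \<Rightarrow> 'a) set" where
  "strategies Ti Ai = measurable (borel_on Ti) (borel_on Ai)"

definition play :: "('n::finite \<Rightarrow> 't::euclidean_space \<Rightarrow> 'a::euclidean_space) \<Rightarrow> 't ^ 'n \<Rightarrow> 'a ^ 'n" where
  "play f \<theta> = (\<chi> j. f j (\<theta> $ j))"

definition expected_utility ::
    "('n::finite \<Rightarrow> 'a::euclidean_space ^ 'n \<Rightarrow> 't::euclidean_space ^ 'n \<Rightarrow> real) \<Rightarrow>
     ('n \<Rightarrow> 't \<Rightarrow> ('t ^ 'n) measure) \<Rightarrow> 'n \<Rightarrow> 'a \<Rightarrow> ('n \<Rightarrow> 't \<Rightarrow> 'a) \<Rightarrow> 't \<Rightarrow> real" where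
  "expected_utility u \<mu>c i x f t = (\<integral>\<theta>. u i (join i x (play f \<theta>)) (join i t \<theta>) \<partial>\<mu>c i t)"

definition BNE ::
    "('n::finite \<Rightarrow> 't::euclidean_space set) \<Rightarrow> ('n \<Rightarrow> 'a::euclidean_space set) \<Rightarrow>
     ('n \<Rightarrow> 'a ^ 'n \<Rightarrow> 't ^ 'n \<Rightarrow> real) \<Rightarrow> ('n \<Rightarrow> 't \<Rightarrow> ('t ^ 'n) measure) \<Rightarrow>
     ('n \<Rightarrow> 't \<Rightarrow> 'a) \<Rightarrow> bool" where
  "BNE T A u \<mu>c f \<longleftrightarrow> (\<forall>i. f i \<in> strategies (T i) (A i)) \<and>
     (\<forall>i. \<forall>t \<in> T i. is_arg_max (\<lambda>x. expected_utility u \<mu>c i x f t) (\<lambda>x. x \<in> A i) (f i t))"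

text \<open>
  \<open>g i a \<theta>\<close> is the gradient of player \<open>i\<close>'s utility in her own action. The derivative is taken within
  \<open>A i\<close>, because utilities are only given there. If \<open>A i\<close> has empty interior, this does not determine
  \<open>g\<close>; then \<open>g\<close> stands for any choice.
\<close>

definition own_gradient ::
    "('n::finite \<Rightarrow> 't::euclidean_space set) \<Rightarrow> ('n \<Rightarrow> 'a::euclidean_space set) \<Rightarrow>
     ('n \<Rightarrow> 'a ^ 'n \<Rightarrow> 't ^ 'n \<Rightarrow> real) \<Rightarrow> ('n \<Rightarrow> 'a ^ 'n \<Rightarrow> 't ^ 'n \<Rightarrow> 'a) \<Rightarrow> bool" where
  "own_gradient T A u g \<longleftrightarrow> (\<forall>i. \<forall>a \<in> profiles A. \<forall>\<theta> \<in> profiles T.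
     ((\<lambda>x. u i (join i x a) \<theta>) has_derivative (\<lambda>v. g i a \<theta> \<bullet> v)) (at (a $ i) within A i))"

section \<open>Assumptions\<close>

definition assumption_A ::
    "('n::finite \<Rightarrow> 't::euclidean_space set) \<Rightarrow> ('n \<Rightarrow> 'a::euclidean_space set) \<Rightarrow>
     ('n \<Rightarrow> 'a ^ 'n \<Rightarrow> 't ^ 'n \<Rightarrow> real) \<Rightarrow> ('n \<Rightarrow> 'a ^ 'n \<Rightarrow> 't ^ 'n \<Rightarrow> 'a) \<Rightarrow>
     ('n \<Rightarrow> 't \<Rightarrow> ('t ^ 'n) measure) \<Rightarrow> bool" where
  "assumption_A T A u g \<eta>c \<longleftrightarrow> (\<forall>i.
     continuous_on (profiles A \<times> profiles T) (\<lambda>(a, \<theta>). u i a \<theta>) \<and>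
     (\<forall>\<theta> \<in> profiles T. continuous_on (profiles A) (\<lambda>a. g i a \<theta>)) \<and>
     (\<forall>a \<in> profiles A. (\<lambda>\<theta>. g i a \<theta>) \<in> borel_measurable (borel_on (profiles T))) \<and>
     (\<forall>x \<in> A i. \<forall>f. (\<forall>j. j \<noteq> i \<longrightarrow> f j \<in> strategies (T j) (A j)) \<longrightarrow>
        (\<exists>h :: 't \<Rightarrow> 't ^ 'n \<Rightarrow> real.
           (\<forall>t \<in> T i. \<forall>\<theta> \<in> others T i. 0 \<le> h t \<theta>) \<and>
           (\<forall>t \<in> T i. integrable (\<eta>c i t) (h t)) \<and>
           (\<forall>t \<in> T i. \<exists>U. openin (top_of_set (A i)) U \<and> x \<in> U \<and>
              (\<forall>y \<in> U. \<forall>\<theta> \<in> others T i.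
                 norm (g i (join i y (play f \<theta>)) (join i t \<theta>)) \<le> h t \<theta>)))) \<and>
     meas_conditional T \<eta>c i)"

definition assumption_B ::
    "('n::finite \<Rightarrow> 't::euclidean_space set) \<Rightarrow> ('n \<Rightarrow> 'a::euclidean_space set) \<Rightarrow>
     ('n \<Rightarrow> 'a ^ 'n \<Rightarrow> 't ^ 'n \<Rightarrow> 'a) \<Rightarrow> ('n \<Rightarrow> real) \<Rightarrow> ('n \<Rightarrow> 'n \<Rightarrow> real) \<Rightarrow> bool" where
  "assumption_B T A g \<sigma> \<tau> \<longleftrightarrow> (\<forall>i.
     0 < \<sigma> i \<and>
     (\<forall>x \<in> A i. \<forall>x' \<in> A i. \<forall>a \<in> others A i. \<forall>\<theta> \<in> profiles T.
        (g i (join i x a) \<theta> - g i (join i x' a) \<theta>) \<bullet> (x - x') \<le> - \<sigma> i * (norm (x - x'))\<^sup>2) \<and>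
     (\<forall>j. j \<noteq> i \<longrightarrow> 0 \<le> \<tau> i j) \<and>
     (\<forall>x \<in> A i. \<forall>a \<in> others A i. \<forall>a' \<in> others A i. \<forall>\<theta> \<in> profiles T.
        norm (g i (join i x a) \<theta> - g i (join i x a') \<theta>)
          \<le> (\<Sum>j \<in> UNIV - {i}. \<tau> i j * norm (a $ j - a' $ j))))"

definition nu_sup ::
    "('n::finite \<Rightarrow> 't::euclidean_space set) \<Rightarrow> ('n \<Rightarrow> 't \<Rightarrow> ('t ^ 'n) measure) \<Rightarrow>
     ('n \<Rightarrow> 't ^ 'n \<Rightarrow> real) \<Rightarrow> 'n \<Rightarrow> ennreal" where
  "nu_sup T \<eta>c \<nu> i = (SUP t \<in> T i. \<integral>\<^sup>+\<theta>. ennreal (\<nu> i \<theta>) \<partial>\<eta>c i t)"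

definition assumption_C ::
    "('n::finite \<Rightarrow> 't::euclidean_space set) \<Rightarrow> ('n \<Rightarrow> 'a::euclidean_space set) \<Rightarrow>
     ('n \<Rightarrow> 'a ^ 'n \<Rightarrow> 't ^ 'n \<Rightarrow> 'a) \<Rightarrow> ('n \<Rightarrow> 't \<Rightarrow> ('t ^ 'n) measure) \<Rightarrow>
     ('n \<Rightarrow> 't ^ 'n \<Rightarrow> real) \<Rightarrow> ('n \<Rightarrow> real) \<Rightarrow> bool" where
  "assumption_C T A g \<eta>c \<nu> \<gamma> \<longleftrightarrow> (\<forall>i.
     bdd_above ((\<lambda>(a, \<theta>). norm (g i a \<theta>)) ` (profiles A \<times> profiles T)) \<and>
     (\<forall>\<theta> \<in> others T i. 0 \<le> \<nu> i \<theta>) \<and>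
     \<nu> i \<in> borel_measurable (borel_on (others T i)) \<and>
     (\<forall>a \<in> profiles A. \<forall>t \<in> T i. \<forall>t' \<in> T i. \<forall>\<theta> \<in> others T i.
        norm (g i a (join i t \<theta>) - g i a (join i t' \<theta>)) \<le> \<nu> i \<theta> * norm (t - t')) \<and>
     nu_sup T \<eta>c \<nu> i < \<infinity> \<and>
     0 < \<gamma> i \<and>
     (\<forall>t \<in> T i. \<forall>t' \<in> T i. d_TV (\<eta>c i t) (\<eta>c i t') \<le> \<gamma> i * norm (t - t')))"

definition assumption_E ::
    "('n::finite \<Rightarrow> 't::euclidean_space set) \<Rightarrow> ('n \<Rightarrow> 'a::euclidean_space set) \<Rightarrow>
     ('n \<Rightarrow> 'a ^ 'n \<Rightarrow> 't ^ 'n \<Rightarrow> 'a) \<Rightarrow> ('n \<Rightarrow> real) \<Rightarrow> bool" where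
  "assumption_E T A g \<rho> \<longleftrightarrow> (\<forall>i.
     \<forall>\<theta> \<in> others T i. \<forall>\<theta>' \<in> others T i. \<forall>a \<in> profiles A. \<forall>t \<in> T i.
       norm (g i a (join i t \<theta>) - g i a (join i t \<theta>')) \<le> \<rho> i * norm (\<theta> - \<theta>'))"

section \<open>Constants\<close>

definition diag_matrix :: "('n::finite \<Rightarrow> real) \<Rightarrow> real ^ 'n ^ 'n" where
  "diag_matrix w = (\<chi> i j. if i = j then w i else 0)"

definition matrix_norm_inf :: "real ^ 'n::finite ^ 'n \<Rightarrow> real" where
  "matrix_norm_inf B = (MAX i \<in> UNIV. \<Sum>j \<in> UNIV. \<bar>B $ i $ j\<bar>)"

definition interaction_matrix :: "('n::finite \<Rightarrow> real) \<Rightarrow> ('n \<Rightarrow> 'n \<Rightarrow> real) \<Rightarrow> real ^ 'n ^ 'n" where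
  "interaction_matrix \<sigma> \<tau> = (\<chi> i j. if i = j then 0 else \<tau> i j / \<sigma> i)"

definition contraction_const ::
    "('n::finite \<Rightarrow> real) \<Rightarrow> ('n \<Rightarrow> 'n \<Rightarrow> real) \<Rightarrow> ('n \<Rightarrow> real) \<Rightarrow> real" where
  "contraction_const \<sigma> \<tau> w =
     matrix_norm_inf (matrix_inv (diag_matrix w) ** interaction_matrix \<sigma> \<tau> ** diag_matrix w)"

definition kappa ::
    "('n::finite \<Rightarrow> 't::euclidean_space set) \<Rightarrow> ('n \<Rightarrow> 'a::euclidean_space set) \<Rightarrow>
     ('n \<Rightarrow> 'a ^ 'n \<Rightarrow> 't ^ 'n \<Rightarrow> 'a) \<Rightarrow> ('n \<Rightarrow> 't \<Rightarrow> ('t ^ 'n) measure) \<Rightarrow>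
     ('n \<Rightarrow> 't ^ 'n \<Rightarrow> real) \<Rightarrow> ('n \<Rightarrow> real) \<Rightarrow> 'n \<Rightarrow> real" where
  "kappa T A g \<eta>c \<nu> \<gamma> j = enn2real (nu_sup T \<eta>c \<nu> j)
     + 2 * \<gamma> j * (SUP (a, \<theta>) \<in> profiles A \<times> profiles T. norm (g j a \<theta>))"

definition tau_total :: "('n::finite \<Rightarrow> real) \<Rightarrow> ('n \<Rightarrow> 'n \<Rightarrow> real) \<Rightarrow> ('n \<Rightarrow> real) \<Rightarrow> 'n \<Rightarrow> real" where
  "tau_total \<sigma> \<tau> k i = sqrt (\<Sum>j \<in> UNIV - {i}. (\<tau> i j)\<^sup>2 * (k j / \<sigma> j)\<^sup>2)"

end

theory Submission
  imports Defs
begin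

text \<open>
  A maximiser \<open>x\<close> of a differentiable function over a convex set satisfies a variational inequality:
  the expected marginal utility at \<open>x\<close>, in the direction of any other action \<open>y\<close>, is not positive.
  Let two best responses \<open>x\<close> and \<open>y\<close> of player \<open>i\<close> be given, possibly to different strategies, own
  types and beliefs. Testing the inequality of each against the other and using that the own gradient
  is strongly monotone with modulus \<open>\<sigma>\<^sub>i\<close> gives
  \[ \sigma_i \|y - x\|^2 \le E' [G'(x) \cdot (y - x)] - E [G(x) \cdot (y - x)], \]
  where $G$, $G'$ are the marginal utilities and $E$, $E'$ the expectations in the two situations
  (\<open>best_response_distance\<close>). Both gradients are taken at the same action, so the right-hand side only
  sees how the situations differ. It is used twice.

  First, compare the responses at two types of one player in one equilibrium. The situations differ in
  the own type, which costs $\overline\nu_i \|t' - t\|$, and in the conditional belief, which costs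
  $2 \gamma_i \|t' - t\| \sup \|G\|$ by total variation. So the equilibrium strategy under \<open>\<eta>\<close> is
  Lipschitz with constant \<open>\<kappa>\<^sub>i / \<sigma>\<^sub>i\<close> (\<open>equilibrium_type_Lipschitz\<close>).

  Second, compare the responses of one type in the two equilibria. The opponents' change of strategy
  costs $\sum_j \tau_{ij} \sup \|f_{j,\eta} - f_{j,\mu}\|$. The change of belief is charged while the
  opponents still play the equilibrium under \<open>\<eta>\<close>, the one known to be Lipschitz: the integrand is
  then, up to the factor $\|y - x\|$, a Lipschitz function of the opponents' types with constant
  \<open>\<tau>\<^sub>i + \<rho>\<^sub>i\<close>, so the Kantorovich distance bounds the difference of the integrals
  (\<open>best_response_stability\<close>).

  In the norm weighted by \<open>w\<close> the strategy term is at most \<open>\<alpha>\<close> times the distance $m$ of the two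
  equilibria (\<open>contraction_const_row\<close>). Hence $m \le \alpha m + (1 - \alpha) R$ with $R$ the claimed
  bound, and $m \le R$ because \<open>\<alpha> < 1\<close>.
\<close>

section \<open>Profiles\<close>

lemma join_nth: "join i v x $ j = (if j = i then v else x $ j)"
  by (simp add: join_def)

lemma play_nth: "play f \<theta> $ j = f j (\<theta> $ j)"
  by (simp add: play_def)

lemma join_drop_player: "join i v (drop_player i x) = join i v x"
  by (simp add: join_def drop_player_def vec_eq_iff)

lemma join_join: "join i v (join i v' x) = join i v x"
  by (simp add: join_def vec_eq_iff)

lemma join_in_profiles: "v \<in> X i \<Longrightarrow> x \<in> others X i \<Longrightarrow> join i v x \<in> profiles X"
  by (auto simp: join_nth others_def profiles_def)

lemma space_strategies: "f \<in> strategies S B \<Longrightarrow> t \<in> S \<Longrightarrow> f t \<in> B"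
  using measurable_space[of f "borel_on S" "borel_on B" t]
  by (simp add: strategies_def borel_on_def space_restrict_space)

lemma drop_play_in_others:
  assumes "\<And>j. f j \<in> strategies (T j) (A j)" and "\<theta> \<in> others T i"
  shows "drop_player i (play f \<theta>) \<in> others A i"
  using assms(2) space_strategies[OF assms(1)] by (auto simp: others_def drop_player_def play_nth)

lemma join_play_in_profiles:
  assumes "\<And>j. f j \<in> strategies (T j) (A j)" and "\<theta> \<in> others T i" and "x \<in> A i"
  shows "join i x (play f \<theta>) \<in> profiles A"
  using join_in_profiles[where X=A, OF assms(3) drop_play_in_others[OF assms(1,2)]]
  by (simp add: join_drop_player)

lemma norm_vec_le_sum: "norm (x :: 'x::euclidean_space ^ 'n::finite) \<le> (\<Sum>j\<in>UNIV. norm (x $ j))"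
  unfolding norm_vec_def by (rule L2_set_le_sum) simp

lemma compact_profiles:
  fixes X :: "'n::finite \<Rightarrow> 'x::euclidean_space set"
  assumes "\<And>i. compact (X i)"
  shows "compact (profiles X)"
proof -
  have "closed (profiles X)"
    unfolding profiles_def by (intro closed_vector_box allI compact_imp_closed assms)
  moreover have "bounded (profiles X)"
  proof -
    have "\<forall>i. \<exists>b. \<forall>v \<in> X i. norm v \<le> b"
      using compact_imp_bounded[OF assms] by (auto simp: bounded_iff)
    then obtain b where b: "\<And>i v. v \<in> X i \<Longrightarrow> norm v \<le> b i" by metis
    have "norm x \<le> (\<Sum>j\<in>UNIV. b j)" if "x \<in> profiles X" for x
      using norm_vec_le_sum[of x] sum_mono[of UNIV "\<lambda>j. norm (x $ j)" b] b that
      by (force simp: profiles_def)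
    then show ?thesis by (auto simp: bounded_iff)
  qed
  ultimately show ?thesis by (simp add: compact_eq_bounded_closed)
qed

lemma bounded_others:
  fixes X :: "'n::finite \<Rightarrow> 'x::euclidean_space set"
  assumes "\<And>i. compact (X i)"
  shows "bounded (others X i)"
proof -
  have "others X i \<subseteq> profiles (X(i := {0}))" by (auto simp: others_def profiles_def)
  moreover have "compact (profiles (X(i := {0})))" by (rule compact_profiles) (simp add: assms)
  ultimately show ?thesis using bounded_subset compact_imp_bounded by blast
qed

lemma measurable_vec:
  fixes h :: "'b \<Rightarrow> 'x::euclidean_space ^ 'n::finite"
  assumes "\<And>j. (\<lambda>x. h x $ j) \<in> borel_measurable M"
  shows "h \<in> borel_measurable M"
proof (subst borel_measurable_euclidean_space, intro ballI)
  fix b :: "'x ^ 'n" assume "b \<in> Basis"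
  then obtain j c where "b = axis j c" by (auto simp: Basis_vec_def)
  then show "(\<lambda>x. h x \<bullet> b) \<in> borel_measurable M"
    using assms[of j] by (simp add: inner_axis)
qed

section \<open>Distances between probability measures\<close>

lemma Lipschitz_integrable:
  fixes X :: "'x::euclidean_space set"
  assumes P: "prob_space P" "sets P = sets (borel_on X)" and X: "bounded X"
    and h: "L-lipschitz_on X h"
  shows "integrable P (h :: 'x \<Rightarrow> real)"
proof -
  interpret prob_space P by fact
  have sp: "space P = X" using sets_eq_imp_space_eq[OF P(2)] by (simp add: borel_on_def space_restrict_space)
  have "h \<in> borel_measurable (borel_on X)"
    unfolding borel_on_def by (intro borel_measurable_continuous_on_restrict lipschitz_on_continuous_on[OF h])
  then have "h \<in> borel_measurable P" using measurable_cong_sets[OF P(2) refl] by blast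
  moreover have "bounded (h ` X)"
    using bounded_uniformly_continuous_image[OF lipschitz_on_uniformly_continuous[OF h] X] .
  then obtain B where "\<And>x. x \<in> X \<Longrightarrow> norm (h x) \<le> B" by (auto simp: bounded_iff)
  ultimately show ?thesis by (intro integrable_const_bound[where B=B]) (auto simp: sp)
qed

lemma Lipschitz_integral_diff_le:
  fixes X :: "'x::euclidean_space set" and h :: "'x \<Rightarrow> real"
  assumes P: "prob_space P" "sets P = sets (borel_on X)"
    and Q: "prob_space Q" "sets Q = sets (borel_on X)" and X: "bounded X"
    and h: "L-lipschitz_on X h"
  shows "\<bar>(\<integral>x. h x \<partial>P) - (\<integral>x. h x \<partial>Q)\<bar> \<le> 2 * (L * diameter X)"
proof -
  have sp: "space P = X" "space Q = X"
    using sets_eq_imp_space_eq[OF P(2)] sets_eq_imp_space_eq[OF Q(2)]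
    by (simp_all add: borel_on_def space_restrict_space)
  obtain x0 where x0: "x0 \<in> X" using prob_space.not_empty[OF P(1)] sp by auto
  have osc: "\<bar>h x - h x0\<bar> \<le> L * diameter X" if "x \<in> X" for x
    using lipschitz_onD[OF h that x0] diameter_bounded_bound[OF X that x0] lipschitz_on_nonneg[OF h]
    by (metis dist_real_def mult_left_mono order_trans)
  have "\<bar>(\<integral>x. h x \<partial>R) - h x0\<bar> \<le> L * diameter X"
    if R: "prob_space R" "sets R = sets (borel_on X)" "space R = X" for R
  proof -
    interpret prob_space R by fact
    have int: "integrable R h" by (rule Lipschitz_integrable[OF R(1,2) X h])
    have "(\<integral>x. h x \<partial>R) - h x0 = (\<integral>x. h x - h x0 \<partial>R)" using int by (simp add: prob_space)
    also have "\<bar>\<dots>\<bar> \<le> (\<integral>x. \<bar>h x - h x0\<bar> \<partial>R)" by (rule integral_abs_bound)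
    also have "\<dots> \<le> L * diameter X"
      using int by (intro integral_le_const AE_I2) (auto simp: R(3) osc)
    finally show ?thesis .
  qed
  from this[OF P sp(1)] this[OF Q sp(2)] show ?thesis by linarith
qed

context
  fixes X :: "'x::euclidean_space set" and P Q :: "'x measure"
  assumes P: "prob_space P" "sets P = sets (borel_on X)"
    and Q: "prob_space Q" "sets Q = sets (borel_on X)"
    and X: "bounded X"
begin

lemma space_eq: "space P = X" "space Q = X"
  using sets_eq_imp_space_eq[OF P(2)] sets_eq_imp_space_eq[OF Q(2)]
  by (simp_all add: borel_on_def space_restrict_space)

lemma bdd_above_d_K:
  "bdd_above ((\<lambda>h :: 'x \<Rightarrow> real. \<bar>(\<integral>x. h x \<partial>P) - (\<integral>x. h x \<partial>Q)\<bar>) `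
     {h. 1-lipschitz_on (space P) h})"
  by (rule bdd_aboveI2[where M="2 * (1 * diameter X)"])
    (auto simp: space_eq intro!: Lipschitz_integral_diff_le[OF P Q X, where L=1, simplified])

lemma d_K_nonneg: "0 \<le> d_K P Q"
  unfolding d_K_def
  by (rule cSUP_upper2[OF bdd_above_d_K, where x="\<lambda>_. 0"]) (auto intro: lipschitz_onI)

lemma d_K_le: "d_K P Q \<le> 2 * diameter X"
  unfolding d_K_def
proof (rule cSUP_least)
  have "(\<lambda>_. 0) \<in> {h :: 'x \<Rightarrow> real. 1-lipschitz_on (space P) h}" by (auto intro: lipschitz_onI)
  then show "{h :: 'x \<Rightarrow> real. 1-lipschitz_on (space P) h} \<noteq> {}" by blast
qed (auto simp: space_eq intro!: Lipschitz_integral_diff_le[OF P Q X, where L=1, simplified])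

text \<open>
  For positive \<open>L\<close> this is the definition of the distance after scaling by \<open>L\<close>. For \<open>L = 0\<close> the
  function is constant. A negative \<open>L\<close> is possible only if \<open>X\<close> is a single point, where the distance
  vanishes; this case matters because a Lipschitz constant of the gradient in the opponents' types is
  not required to be nonnegative.
\<close>

lemma integral_diff_le_d_K:
  fixes h :: "'x \<Rightarrow> real"
  assumes h: "\<And>x y. x \<in> X \<Longrightarrow> y \<in> X \<Longrightarrow> \<bar>h x - h y\<bar> \<le> L * dist x y"
  shows "\<bar>(\<integral>x. h x \<partial>P) - (\<integral>x. h x \<partial>Q)\<bar> \<le> L * d_K P Q"
proof (cases "0 < L")
  case True
  have "1-lipschitz_on X (\<lambda>x. h x / L)"
  proof (rule lipschitz_onI)
    fix x y assume "x \<in> X" "y \<in> X"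
    then show "dist (h x / L) (h y / L) \<le> 1 * dist x y"
      using h[of x y] True by (simp add: dist_real_def diff_divide_distrib[symmetric] field_simps)
  qed simp
  then have "\<bar>(\<integral>x. h x / L \<partial>P) - (\<integral>x. h x / L \<partial>Q)\<bar> \<le> d_K P Q"
    unfolding d_K_def by (intro cSUP_upper bdd_above_d_K) (simp add: space_eq)
  then show ?thesis using True by (simp add: diff_divide_distrib[symmetric] field_simps)
next
  case False
  have zero: "(\<integral>x. k x \<partial>P) - (\<integral>x. k x \<partial>Q) = 0" if "0-lipschitz_on X k" for k :: "'x \<Rightarrow> real"
    using Lipschitz_integral_diff_le[OF P Q X that] by simp
  have "0-lipschitz_on X h"
  proof (rule lipschitz_onI)
    fix x y assume "x \<in> X" "y \<in> X"
    then show "dist (h x) (h y) \<le> 0 * dist x y"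
      using h[of x y] False mult_nonpos_nonneg[of L "dist x y"] by (auto simp: dist_real_def)
  qed simp
  then have h0: "(\<integral>x. h x \<partial>P) - (\<integral>x. h x \<partial>Q) = 0" by (rule zero)
  have "L * d_K P Q = 0"
  proof (cases "L = 0")
    case False
    with \<open>\<not> 0 < L\<close> have "L < 0" by simp
    have single: "x = y" if "x \<in> X" "y \<in> X" for x y
    proof -
      have "0 \<le> L * dist x y" using h[OF that] by linarith
      then show ?thesis using \<open>L < 0\<close> by (simp add: zero_le_mult_iff)
    qed
    have "\<bar>(\<integral>x. k x \<partial>P) - (\<integral>x. k x \<partial>Q)\<bar> = 0" for k :: "'x \<Rightarrow> real"
      using zero[of k] single by (force intro!: lipschitz_onI)
    then have "d_K P Q \<le> 0"
      unfolding d_K_def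
      by (intro cSUP_least) (auto intro!: exI[of _ "\<lambda>_. 0"] lipschitz_onI)
    then show ?thesis using d_K_nonneg by simp
  qed simp
  with h0 show ?thesis by linarith
qed

lemma integral_diff_le_d_TV:
  assumes h: "h \<in> borel_measurable P" "\<And>x. x \<in> X \<Longrightarrow> \<bar>h x\<bar> \<le> B" and "0 \<le> B"
  shows "\<bar>(\<integral>x. h x \<partial>P) - (\<integral>x. h x \<partial>Q)\<bar> \<le> 2 * B * d_TV P Q"
proof (cases "B = 0")
  case True
  then have "(\<integral>x. h x \<partial>P) = (\<integral>x. 0 \<partial>P)" "(\<integral>x. h x \<partial>Q) = (\<integral>x. 0 \<partial>Q)"
    using h(2) by (intro Bochner_Integration.integral_cong refl; simp add: space_eq)+
  then show ?thesis using True by simp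
next
  case False
  let ?H = "{h :: 'x \<Rightarrow> real. h \<in> borel_measurable P \<and> (\<forall>x \<in> space P. \<bar>h x\<bar> \<le> 1)}"
  have bd: "\<bar>\<integral>x. k x \<partial>R\<bar> \<le> 1"
    if "prob_space R" "k \<in> borel_measurable R" "\<And>x. x \<in> space R \<Longrightarrow> \<bar>k x\<bar> \<le> 1"
    for R :: "'x measure" and k :: "'x \<Rightarrow> real"
  proof -
    interpret prob_space R by fact
    have "integrable R k" using that by (intro integrable_const_bound[where B=1]) auto
    then have "(\<integral>x. \<bar>k x\<bar> \<partial>R) \<le> 1" using that by (intro integral_le_const) auto
    then show ?thesis using integral_abs_bound[of R k] by linarith
  qed
  have "\<bar>(\<integral>x. k x \<partial>P) - (\<integral>x. k x \<partial>Q)\<bar> \<le> 2" if "k \<in> ?H" for k :: "'x \<Rightarrow> real"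
  proof -
    have "k \<in> borel_measurable Q" using that measurable_cong_sets[of P Q "borel :: real measure" borel] P(2) Q(2) by auto
    then show ?thesis using bd[OF P(1), of k] bd[OF Q(1), of k] that by (auto simp: space_eq)
  qed
  then have "bdd_above ((\<lambda>h. \<bar>(\<integral>x. h x \<partial>P) - (\<integral>x. h x \<partial>Q)\<bar>) ` ?H)" by (rule bdd_aboveI2)
  moreover have "(\<lambda>x. h x / B) \<in> ?H" using h False \<open>0 \<le> B\<close> by (auto simp: space_eq)
  ultimately have "\<bar>(\<integral>x. h x / B \<partial>P) - (\<integral>x. h x / B \<partial>Q)\<bar> \<le> 2 * d_TV P Q"
    unfolding d_TV_def by (auto intro: cSUP_upper2)
  then show ?thesis using False \<open>0 \<le> B\<close> by (simp add: diff_divide_distrib[symmetric] field_simps)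
qed

end


section \<open>First-order conditions\<close>

lemma segment_eq: "x + s *\<^sub>R (y - x) = (1 - s) *\<^sub>R x + s *\<^sub>R (y :: 'x::real_vector)"
  by (simp add: algebra_simps)

text \<open>
  The derivative is only given within \<open>S\<close>, and \<open>S\<close> may have empty interior, so the directional
  derivative is obtained along the segment from \<open>x\<close> to \<open>y\<close>, which stays in \<open>S\<close>. A sequence of step sizes
  is used so that measurability and dominated convergence apply to the quotients.
\<close>

lemma segment_difference_quotients:
  fixes F :: "'x::euclidean_space \<Rightarrow> real"
  assumes F: "(F has_derivative (\<lambda>v. G \<bullet> v)) (at x within S)"
    and S: "convex S" "x \<in> S" "y \<in> S"
  shows "(\<lambda>n. (F (x + inverse (real (Suc n)) *\<^sub>R (y - x)) - F x) * real (Suc n))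
           \<longlonglongrightarrow> G \<bullet> (y - x)"
proof -
  let ?p = "\<lambda>s::real. x + s *\<^sub>R (y - x)"
  have sub: "?p ` {0..1} \<subseteq> S" using convexD_alt[OF S] by (auto simp: segment_eq)
  have "(?p has_derivative (\<lambda>s. s *\<^sub>R (y - x))) (at 0 within {0..1})"
    by (auto intro!: derivative_eq_intros)
  moreover have "(F has_derivative (\<lambda>v. G \<bullet> v)) (at (?p 0) within ?p ` {0..1})"
    using has_derivative_subset[OF F sub] by simp
  ultimately have "((\<lambda>s. F (?p s)) has_derivative (\<lambda>s. G \<bullet> (s *\<^sub>R (y - x)))) (at 0 within {0..1})"
    by (rule has_derivative_in_compose)
  then have "((\<lambda>s. F (?p s)) has_field_derivative G \<bullet> (y - x)) (at 0 within {0..1})"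
    by (simp add: has_field_derivative_def mult.commute[of _ "G \<bullet> (y - x)"] mult_commute_abs)
  then have lim: "((\<lambda>s. (F (?p s) - F x) / s) \<longlongrightarrow> G \<bullet> (y - x)) (at 0 within {0..1})"
    by (simp add: has_field_derivative_iff)
  have "filterlim (\<lambda>n. inverse (real (Suc n))) (at 0 within {0..1}) sequentially"
    unfolding filterlim_at using LIMSEQ_inverse_real_of_nat by (auto simp: field_simps)
  from filterlim_compose[OF lim this] show ?thesis by (simp add: divide_inverse)
qed

definition marginal_utility ::
    "('n::finite \<Rightarrow> 'a::euclidean_space ^ 'n \<Rightarrow> 't::euclidean_space ^ 'n \<Rightarrow> 'a) \<Rightarrow>
     ('n \<Rightarrow> 't \<Rightarrow> 'a) \<Rightarrow> 'n \<Rightarrow> 't \<Rightarrow> 'a \<Rightarrow> 't ^ 'n \<Rightarrow> 'a" where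
  "marginal_utility g f i t x \<theta> = g i (join i x (play f \<theta>)) (join i t \<theta>)"

text \<open>
  The part of the assumptions that concerns the shape of the payoffs and not the beliefs, so that one
  instance serves both distributions. The bound \<open>C\<close> dominates the difference quotients of the utility,
  whatever the belief.
\<close>

locale concave_game =
  fixes T :: "'n::finite \<Rightarrow> 't::euclidean_space set"
    and A :: "'n \<Rightarrow> 'a::euclidean_space set"
    and u :: "'n \<Rightarrow> 'a ^ 'n \<Rightarrow> 't ^ 'n \<Rightarrow> real"
    and g :: "'n \<Rightarrow> 'a ^ 'n \<Rightarrow> 't ^ 'n \<Rightarrow> 'a"
    and C \<sigma> :: "'n \<Rightarrow> real"
  assumes sets: "game_sets T A"
    and gradient: "own_gradient T A u g"
    and u_continuous: "continuous_on (profiles A \<times> profiles T) (\<lambda>(a, \<theta>). u i a \<theta>)"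
    and g_bounded: "a \<in> profiles A \<Longrightarrow> \<theta> \<in> profiles T \<Longrightarrow> norm (g i a \<theta>) \<le> C i"
    and sigma_pos: "0 < \<sigma> i"
    and monotone: "x \<in> A i \<Longrightarrow> x' \<in> A i \<Longrightarrow> a \<in> others A i \<Longrightarrow> \<theta> \<in> profiles T \<Longrightarrow>
        (g i (join i x a) \<theta> - g i (join i x' a) \<theta>) \<bullet> (x - x') \<le> - \<sigma> i * (norm (x - x'))\<^sup>2"
begin

abbreviation "strategy_profile f \<equiv> \<forall>j. f j \<in> strategies (T j) (A j)"

abbreviation "belief i P \<equiv> prob_space P \<and> sets P = sets (borel_on (others T i))"

lemma A_convex: "convex (A i)" and A_compact: "compact (A i)" and T_compact: "compact (T i)"
  and A_nonempty: "A i \<noteq> {}" and T_nonempty: "T i \<noteq> {}"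
  using sets by (auto simp: game_sets_def)

lemma belief_space: "belief i P \<Longrightarrow> space P = others T i"
  using sets_eq_imp_space_eq[of P "borel_on (others T i)"] by (simp add: borel_on_def space_restrict_space)

lemma join_play: "strategy_profile f \<Longrightarrow> \<theta> \<in> others T i \<Longrightarrow> x \<in> A i \<Longrightarrow> join i x (play f \<theta>) \<in> profiles A"
  using join_play_in_profiles[where T=T and A=A] by blast

lemma norm_marginal_utility_le:
  assumes "strategy_profile f" "\<theta> \<in> others T i" "x \<in> A i" "t \<in> T i"
  shows "norm (marginal_utility g f i t x \<theta>) \<le> C i"
  unfolding marginal_utility_def using assms by (intro g_bounded join_play join_in_profiles)

lemma utility_derivative:
  assumes "strategy_profile f" "\<theta> \<in> others T i" "x \<in> A i" "t \<in> T i"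
  shows "((\<lambda>z. u i (join i z (play f \<theta>)) (join i t \<theta>)) has_derivative
     (\<lambda>v. marginal_utility g f i t x \<theta> \<bullet> v)) (at x within A i)"
proof -
  have "((\<lambda>z. u i (join i z (join i x (play f \<theta>))) (join i t \<theta>)) has_derivative
     (\<lambda>v. g i (join i x (play f \<theta>)) (join i t \<theta>) \<bullet> v)) (at (join i x (play f \<theta>) $ i) within A i)"
    using gradient join_play[OF assms(1-3)] join_in_profiles[where X=T, OF assms(4,2)]
    unfolding own_gradient_def by blast
  then show ?thesis by (simp add: join_join join_nth marginal_utility_def)
qed

lemma utility_Lipschitz:
  assumes "strategy_profile f" "\<theta> \<in> others T i" "x \<in> A i" "y \<in> A i" "t \<in> T i"
  shows "\<bar>u i (join i y (play f \<theta>)) (join i t \<theta>) - u i (join i x (play f \<theta>)) (join i t \<theta>)\<bar>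
    \<le> C i * norm (y - x)"
proof -
  have "onorm (\<lambda>v. marginal_utility g f i t z \<theta> \<bullet> v) \<le> C i" if "z \<in> A i" for z
  proof (rule onorm_le)
    fix v
    have "norm (marginal_utility g f i t z \<theta> \<bullet> v) \<le> norm (marginal_utility g f i t z \<theta>) * norm v"
      using Cauchy_Schwarz_ineq2 by simp
    also have "\<dots> \<le> C i * norm v"
      using norm_marginal_utility_le[OF assms(1,2) that assms(5)] by (simp add: mult_right_mono)
    finally show "norm (marginal_utility g f i t z \<theta> \<bullet> v) \<le> C i * norm v" .
  qed
  from differentiable_bound[OF A_convex utility_derivative[OF assms(1,2) _ assms(5)] this assms(4,3)]
  show ?thesis by simp
qed

lemma utility_measurable:
  assumes f: "strategy_profile f" and P: "belief i P" and x: "x \<in> A i" and t: "t \<in> T i"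
  shows "(\<lambda>\<theta>. u i (join i x (play f \<theta>)) (join i t \<theta>)) \<in> borel_measurable P"
proof -
  let ?B = "borel_on (others T i)"
  have nth: "(\<lambda>\<theta>. \<theta> $ j) \<in> borel_measurable ?B" for j
    unfolding borel_on_def by (intro borel_measurable_continuous_on_restrict continuous_intros)
  have act: "(\<lambda>\<theta>. f j (\<theta> $ j)) \<in> borel_measurable ?B" if "j \<noteq> i" for j
  proof -
    have "(\<lambda>\<theta>. \<theta> $ j) \<in> ?B \<rightarrow>\<^sub>M borel_on (T j)"
      using nth that unfolding borel_on_def
      by (intro measurable_restrict_space2) (auto simp: space_restrict_space others_def)
    moreover have "f j \<in> borel_measurable (borel_on (T j))"
      using f unfolding strategies_def borel_on_def by (auto simp: measurable_restrict_space2_iff)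
    ultimately show ?thesis by (rule measurable_compose)
  qed
  have "(\<lambda>\<theta>. join i x (play f \<theta>)) \<in> borel_measurable ?B"
  proof (rule measurable_vec)
    show "(\<lambda>\<theta>. join i x (play f \<theta>) $ j) \<in> borel_measurable ?B" for j
      using act by (cases "j = i") (simp_all add: join_nth play_nth)
  qed
  moreover have "(\<lambda>\<theta>. join i t \<theta>) \<in> borel_measurable ?B"
  proof (rule measurable_vec)
    show "(\<lambda>\<theta>. join i t \<theta> $ j) \<in> borel_measurable ?B" for j
      using nth by (cases "j = i") (simp_all add: join_nth)
  qed
  ultimately have "(\<lambda>\<theta>. (join i x (play f \<theta>), join i t \<theta>)) \<in> borel_measurable ?B"
    by (rule borel_measurable_Pair)
  then have "(\<lambda>\<theta>. (join i x (play f \<theta>), join i t \<theta>))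
      \<in> ?B \<rightarrow>\<^sub>M restrict_space borel (profiles A \<times> profiles T)"
    using join_play[OF f _ x] join_in_profiles[where X=T, OF t]
    by (intro measurable_restrict_space2) (auto simp: borel_on_def space_restrict_space)
  from measurable_compose[OF this borel_measurable_continuous_on_restrict[OF u_continuous[of i]]]
  have "(\<lambda>\<theta>. u i (join i x (play f \<theta>)) (join i t \<theta>)) \<in> borel_measurable ?B" by simp
  then show ?thesis using P measurable_cong_sets by blast
qed

lemma utility_integrable:
  assumes f: "strategy_profile f" and P: "belief i P" and x: "x \<in> A i" and t: "t \<in> T i"
  shows "integrable P (\<lambda>\<theta>. u i (join i x (play f \<theta>)) (join i t \<theta>))"
proof -
  interpret prob_space P using P by simp
  have "compact (profiles A \<times> profiles T)"
    by (intro compact_Times compact_profiles A_compact T_compact)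
  then have "bounded ((\<lambda>(a, \<theta>). u i a \<theta>) ` (profiles A \<times> profiles T))"
    using u_continuous compact_continuous_image compact_imp_bounded by blast
  then obtain B where "\<And>a \<theta>. a \<in> profiles A \<Longrightarrow> \<theta> \<in> profiles T \<Longrightarrow> norm (u i a \<theta>) \<le> B"
    by (force simp: bounded_iff)
  then show ?thesis
    using utility_measurable[OF assms] join_play[OF f _ x] join_in_profiles[where X=T, OF t]
    by (intro integrable_const_bound[where B=B]) (auto simp: belief_space[OF P])
qed

lemma segment_in_A:
  assumes "x \<in> A i" "y \<in> A i"
  shows "x + inverse (real (Suc n)) *\<^sub>R (y - x) \<in> A i"
  unfolding segment_eq by (rule convexD_alt[OF A_convex assms]) (auto simp: field_simps)

text \<open>
  The component of the gradient in an admissible direction is a limit of difference quotients of the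
  utility, which is jointly continuous. Only such components occur in the variational inequalities, so
  measurability of the whole gradient along \<open>f\<close> is never at issue.
\<close>

lemma slope_measurable:
  assumes f: "strategy_profile f" and P: "belief i P" and x: "x \<in> A i" "y \<in> A i" and t: "t \<in> T i"
  shows "(\<lambda>\<theta>. marginal_utility g f i t x \<theta> \<bullet> (y - x)) \<in> borel_measurable P"
proof (rule borel_measurable_LIMSEQ_real)
  fix \<theta> assume "\<theta> \<in> space P"
  then have "\<theta> \<in> others T i" using belief_space[OF P] by simp
  from segment_difference_quotients[OF utility_derivative[OF f this x(1) t] A_convex x]
  show "(\<lambda>n. (u i (join i (x + inverse (real (Suc n)) *\<^sub>R (y - x)) (play f \<theta>)) (join i t \<theta>)
      - u i (join i x (play f \<theta>)) (join i t \<theta>)) * real (Suc n))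
    \<longlonglongrightarrow> marginal_utility g f i t x \<theta> \<bullet> (y - x)" .
qed (intro borel_measurable_times borel_measurable_diff utility_measurable[OF f P _ t] segment_in_A x
    borel_measurable_const)

lemma slope_le:
  assumes "strategy_profile f" "\<theta> \<in> others T i" "x \<in> A i" "t \<in> T i"
  shows "\<bar>marginal_utility g f i t x \<theta> \<bullet> d\<bar> \<le> C i * norm d"
  using Cauchy_Schwarz_ineq2[of "marginal_utility g f i t x \<theta>" d]
    mult_right_mono[OF norm_marginal_utility_le[OF assms], of "norm d"] by simp

lemma slope_integrable:
  assumes f: "strategy_profile f" and P: "belief i P" and x: "x \<in> A i" "y \<in> A i" and t: "t \<in> T i"
  shows "integrable P (\<lambda>\<theta>. marginal_utility g f i t x \<theta> \<bullet> (y - x))"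
proof -
  interpret prob_space P using P by simp
  show ?thesis
    using slope_measurable[OF assms] slope_le[OF f _ x(1) t]
    by (intro integrable_const_bound[where B="C i * norm (y - x)"]) (auto simp: belief_space[OF P])
qed

text \<open>
  The variational inequality of a best response: moving from \<open>x\<close> a short way towards \<open>y\<close> does not raise
  expected utility, and the difference quotients, bounded by the Lipschitz constant \<open>C i\<close> of the
  utility, converge under the integral.
\<close>

lemma expected_slope_nonpos:
  assumes f: "strategy_profile f" and P: "belief i P" and y: "y \<in> A i" and t: "t \<in> T i"
    and opt: "is_arg_max (\<lambda>x. \<integral>\<theta>. u i (join i x (play f \<theta>)) (join i t \<theta>) \<partial>P) (\<lambda>x. x \<in> A i) x"
  shows "(\<integral>\<theta>. marginal_utility g f i t x \<theta> \<bullet> (y - x) \<partial>P) \<le> 0"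
proof -
  interpret prob_space P using P by simp
  have x: "x \<in> A i" and max: "\<And>z. z \<in> A i \<Longrightarrow> (\<integral>\<theta>. u i (join i z (play f \<theta>)) (join i t \<theta>) \<partial>P)
      \<le> (\<integral>\<theta>. u i (join i x (play f \<theta>)) (join i t \<theta>) \<partial>P)"
    using opt by (force simp: is_arg_max_def not_less)+
  let ?z = "\<lambda>n. x + inverse (real (Suc n)) *\<^sub>R (y - x)"
  let ?q = "\<lambda>n \<theta>. (u i (join i (?z n) (play f \<theta>)) (join i t \<theta>)
      - u i (join i x (play f \<theta>)) (join i t \<theta>)) * real (Suc n)"
  note z = segment_in_A[OF x y]
  have "(\<lambda>n. \<integral>\<theta>. ?q n \<theta> \<partial>P) \<longlonglongrightarrow> (\<integral>\<theta>. marginal_utility g f i t x \<theta> \<bullet> (y - x) \<partial>P)"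
  proof (rule integral_dominated_convergence[where w="\<lambda>_. C i * norm (y - x)"])
    show "AE \<theta> in P. (\<lambda>n. ?q n \<theta>) \<longlonglongrightarrow> marginal_utility g f i t x \<theta> \<bullet> (y - x)"
      using segment_difference_quotients[OF utility_derivative[OF f _ x t] A_convex x y]
      by (auto simp: belief_space[OF P])
    fix n
    show "AE \<theta> in P. norm (?q n \<theta>) \<le> C i * norm (y - x)"
    proof (rule AE_I2)
      fix \<theta> assume "\<theta> \<in> space P"
      then have "\<theta> \<in> others T i" using belief_space[OF P] by simp
      from utility_Lipschitz[OF f this x z[of n] t]
      show "norm (?q n \<theta>) \<le> C i * norm (y - x)"
        by (simp add: abs_mult inverse_eq_divide pos_le_divide_eq del: of_nat_Suc)
    qed
    show "?q n \<in> borel_measurable P"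
      by (intro borel_measurable_times borel_measurable_diff utility_measurable[OF f P _ t] z x
          borel_measurable_const)
  qed (use slope_measurable[OF f P x y t] in auto)
  moreover have "(\<integral>\<theta>. ?q n \<theta> \<partial>P) \<le> 0" for n
    using max[OF z[of n]] utility_integrable[OF f P z[of n] t] utility_integrable[OF f P x t]
    by (simp add: mult_nonpos_nonneg del: of_nat_Suc)
  ultimately show ?thesis by (intro LIMSEQ_le_const2) auto
qed

text \<open>
  The comparison principle behind both estimates. Strong monotonicity moves the gradient of the primed
  situation from \<open>y\<close> to \<open>x\<close> at a gain of \<open>\<sigma> i * (norm (y - x))\<^sup>2\<close>; the two variational inequalities
  fix the signs of what remains.
\<close>

lemma best_response_distance:
  assumes f: "strategy_profile f" and P: "belief i P" and t: "t \<in> T i"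
    and x: "is_arg_max (\<lambda>x. \<integral>\<theta>. u i (join i x (play f \<theta>)) (join i t \<theta>) \<partial>P) (\<lambda>x. x \<in> A i) x"
    and f': "strategy_profile f'" and P': "belief i P'" and t': "t' \<in> T i"
    and y: "is_arg_max (\<lambda>x. \<integral>\<theta>. u i (join i x (play f' \<theta>)) (join i t' \<theta>) \<partial>P') (\<lambda>x. x \<in> A i) y"
  shows "\<sigma> i * (norm (y - x))\<^sup>2 \<le> (\<integral>\<theta>. marginal_utility g f' i t' x \<theta> \<bullet> (y - x) \<partial>P')
           - (\<integral>\<theta>. marginal_utility g f i t x \<theta> \<bullet> (y - x) \<partial>P)"
proof -
  interpret P': prob_space P' using P' by simp
  have A: "x \<in> A i" "y \<in> A i" using x y by (auto simp: is_arg_max_def)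
  note int_x = slope_integrable[OF f' P' A t'] and int_y = slope_integrable[OF f' P' A(2,1) t']
  have "\<sigma> i * (norm (y - x))\<^sup>2 - marginal_utility g f' i t' x \<theta> \<bullet> (y - x)
      \<le> marginal_utility g f' i t' y \<theta> \<bullet> (x - y)" if "\<theta> \<in> others T i" for \<theta>
  proof -
    have "drop_player i (play f' \<theta>) \<in> others A i" using drop_play_in_others[where T=T and A=A] f' that by blast
    from monotone[OF A(2,1) this join_in_profiles[where X=T, OF t' that]]
    show ?thesis unfolding marginal_utility_def join_drop_player by (simp add: algebra_simps)
  qed
  then have "(\<integral>\<theta>. \<sigma> i * (norm (y - x))\<^sup>2 - marginal_utility g f' i t' x \<theta> \<bullet> (y - x) \<partial>P')
      \<le> (\<integral>\<theta>. marginal_utility g f' i t' y \<theta> \<bullet> (x - y) \<partial>P')"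
    using int_x int_y by (intro integral_mono) (auto simp: belief_space[OF P'])
  also have "\<dots> \<le> 0" by (rule expected_slope_nonpos[OF f' P' A(1) t' y])
  finally have "\<sigma> i * (norm (y - x))\<^sup>2 \<le> (\<integral>\<theta>. marginal_utility g f' i t' x \<theta> \<bullet> (y - x) \<partial>P')"
    using int_x by (simp add: P'.prob_space)
  with expected_slope_nonpos[OF f P A(2) t x] show ?thesis by simp
qed


lemma C_nonneg: "0 \<le> C i"
proof -
  have "(\<chi> j. SOME v. v \<in> A j) \<in> profiles A" "(\<chi> j. SOME v. v \<in> T j) \<in> profiles T"
    using A_nonempty T_nonempty by (auto simp: profiles_def some_in_eq)
  then show ?thesis using g_bounded norm_ge_zero order_trans by blast
qed

text \<open>
  Passing from type \<open>t\<close> to \<open>t'\<close> is split into a change of belief at the fixed own type \<open>t'\<close>, where only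
  the bound on the gradient is available, and a change of own type under the fixed belief \<open>P\<close>. In this
  order the integral of \<open>\<nu>\<close> is taken under the belief at \<open>t\<close>.
\<close>

lemma equilibrium_type_Lipschitz:
  assumes f: "strategy_profile f"
    and P: "belief i P" and t: "t \<in> T i"
    and x: "is_arg_max (\<lambda>x. \<integral>\<theta>. u i (join i x (play f \<theta>)) (join i t \<theta>) \<partial>P) (\<lambda>x. x \<in> A i) x"
    and P': "belief i P'" and t': "t' \<in> T i"
    and y: "is_arg_max (\<lambda>x. \<integral>\<theta>. u i (join i x (play f \<theta>)) (join i t' \<theta>) \<partial>P') (\<lambda>x. x \<in> A i) y"
    and g: "\<And>a \<theta>. a \<in> profiles A \<Longrightarrow> \<theta> \<in> others T i \<Longrightarrow>
        norm (g i a (join i t' \<theta>) - g i a (join i t \<theta>)) \<le> \<nu> \<theta> * norm (t' - t)"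
    and \<nu>: "integrable P \<nu>" "(\<integral>\<theta>. \<nu> \<theta> \<partial>P) \<le> N" and N: "0 \<le> N"
    and TV: "d_TV P P' \<le> \<gamma> * norm (t' - t)" and \<gamma>: "0 \<le> \<gamma>"
  shows "norm (y - x) \<le> (N + 2 * \<gamma> * C i) / \<sigma> i * norm (t' - t)"
proof (cases "y = x")
  case True
  then show ?thesis using N \<gamma> C_nonneg[of i] sigma_pos[of i] by simp
next
  case False
  let ?d = "y - x"
  have A: "x \<in> A i" "y \<in> A i" using x y by (auto simp: is_arg_max_def)
  note int = slope_integrable[OF f P A t] slope_integrable[OF f P A t']
  have "(\<integral>\<theta>. marginal_utility g f i t' x \<theta> \<bullet> ?d \<partial>P') - (\<integral>\<theta>. marginal_utility g f i t' x \<theta> \<bullet> ?d \<partial>P)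
      \<le> 2 * (C i * norm ?d) * d_TV P P'"
    using integral_diff_le_d_TV[of P "others T i" P' "\<lambda>\<theta>. marginal_utility g f i t' x \<theta> \<bullet> ?d" "C i * norm ?d"]
      P P' bounded_others[OF T_compact] slope_measurable[OF f P A t'] slope_le[OF f _ A(1) t'] C_nonneg
    by force
  also have "\<dots> \<le> 2 * (C i * norm ?d) * (\<gamma> * norm (t' - t))"
    using TV C_nonneg by (intro mult_left_mono) auto
  finally have belief_part: "(\<integral>\<theta>. marginal_utility g f i t' x \<theta> \<bullet> ?d \<partial>P')
      - (\<integral>\<theta>. marginal_utility g f i t' x \<theta> \<bullet> ?d \<partial>P) \<le> 2 * (C i * norm ?d) * (\<gamma> * norm (t' - t))" .
  have "(\<integral>\<theta>. marginal_utility g f i t' x \<theta> \<bullet> ?d \<partial>P) - (\<integral>\<theta>. marginal_utility g f i t x \<theta> \<bullet> ?d \<partial>P)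
      = (\<integral>\<theta>. marginal_utility g f i t' x \<theta> \<bullet> ?d - marginal_utility g f i t x \<theta> \<bullet> ?d \<partial>P)"
    using int by simp
  also have "\<dots> \<le> (\<integral>\<theta>. \<nu> \<theta> * (norm (t' - t) * norm ?d) \<partial>P)"
  proof (rule integral_mono)
    fix \<theta> assume "\<theta> \<in> space P"
    then have \<theta>: "\<theta> \<in> others T i" using belief_space[OF P] by simp
    have "(marginal_utility g f i t' x \<theta> - marginal_utility g f i t x \<theta>) \<bullet> ?d
        \<le> norm (marginal_utility g f i t' x \<theta> - marginal_utility g f i t x \<theta>) * norm ?d"
      by (rule norm_cauchy_schwarz)
    also have "\<dots> \<le> (\<nu> \<theta> * norm (t' - t)) * norm ?d"
      unfolding marginal_utility_def using g[OF join_play[OF f \<theta> A(1)] \<theta>] by (intro mult_right_mono) auto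
    finally show "marginal_utility g f i t' x \<theta> \<bullet> ?d - marginal_utility g f i t x \<theta> \<bullet> ?d
        \<le> \<nu> \<theta> * (norm (t' - t) * norm ?d)" by (simp add: inner_diff_left mult.assoc)
  qed (use int \<nu> in auto)
  also have "\<dots> \<le> N * (norm (t' - t) * norm ?d)" using \<nu>(2) by (simp add: mult_right_mono)
  finally have "\<sigma> i * (norm ?d)\<^sup>2 \<le> 2 * (C i * norm ?d) * (\<gamma> * norm (t' - t)) + N * (norm (t' - t) * norm ?d)"
    using best_response_distance[OF f P t x f P' t' y] belief_part by linarith
  then have "norm ?d * (\<sigma> i * norm ?d) \<le> norm ?d * ((N + 2 * \<gamma> * C i) * norm (t' - t))"
    by (simp add: power2_eq_square algebra_simps)
  then have "\<sigma> i * norm ?d \<le> (N + 2 * \<gamma> * C i) * norm (t' - t)" using False by simp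
  then show ?thesis using sigma_pos[of i] by (simp add: pos_le_divide_eq mult.commute)
qed

text \<open>
  The Cauchy-Schwarz inequality over the opponents turns the weighted sum into the Euclidean norm of
  the type profile; this is why \<open>tau_total\<close> is a root of a sum of squares.
\<close>

lemma play_Lipschitz:
  assumes f: "\<And>j s s'. j \<noteq> i \<Longrightarrow> s \<in> T j \<Longrightarrow> s' \<in> T j \<Longrightarrow> norm (f j s - f j s') \<le> k j / \<sigma> j * norm (s - s')"
    and \<tau>: "\<And>j. j \<noteq> i \<Longrightarrow> 0 \<le> \<tau> i j"
    and \<theta>: "\<theta> \<in> others T i" "\<theta>' \<in> others T i"
  shows "(\<Sum>j\<in>UNIV - {i}. \<tau> i j * norm (f j (\<theta> $ j) - f j (\<theta>' $ j))) \<le> tau_total \<sigma> \<tau> k i * norm (\<theta> - \<theta>')"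
proof -
  have "(\<Sum>j\<in>UNIV - {i}. \<tau> i j * norm (f j (\<theta> $ j) - f j (\<theta>' $ j)))
      \<le> (\<Sum>j\<in>UNIV - {i}. \<bar>\<tau> i j * (k j / \<sigma> j)\<bar> * \<bar>norm ((\<theta> - \<theta>') $ j)\<bar>)"
  proof (rule sum_mono)
    fix j assume j: "j \<in> UNIV - {i}"
    then have "\<tau> i j * norm (f j (\<theta> $ j) - f j (\<theta>' $ j)) \<le> \<tau> i j * (k j / \<sigma> j * norm (\<theta> $ j - \<theta>' $ j))"
      using f \<tau> \<theta> by (intro mult_left_mono) (auto simp: others_def)
    also have "\<dots> \<le> \<bar>\<tau> i j * (k j / \<sigma> j)\<bar> * norm (\<theta> $ j - \<theta>' $ j)"
      by (metis abs_ge_self mult.assoc mult_right_mono norm_ge_zero)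
    finally show "\<tau> i j * norm (f j (\<theta> $ j) - f j (\<theta>' $ j))
        \<le> \<bar>\<tau> i j * (k j / \<sigma> j)\<bar> * \<bar>norm ((\<theta> - \<theta>') $ j)\<bar>" by simp
  qed
  also have "\<dots> \<le> L2_set (\<lambda>j. \<tau> i j * (k j / \<sigma> j)) (UNIV - {i}) * L2_set (\<lambda>j. norm ((\<theta> - \<theta>') $ j)) (UNIV - {i})"
    by (rule L2_set_mult_ineq)
  also have "\<dots> \<le> tau_total \<sigma> \<tau> k i * norm (\<theta> - \<theta>')"
    unfolding L2_set_def tau_total_def norm_vec_def power_mult_distrib
    by (intro mult_left_mono real_sqrt_le_mono sum_mono2) (auto intro!: sum_nonneg)
  finally show ?thesis .
qed

text \<open>
  The intermediate situation is the strategy profile \<open>f\<close> under the belief \<open>P'\<close>. Replacing \<open>f'\<close> by \<open>f\<close>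
  under \<open>P'\<close> uses only the distances \<open>D\<close>; replacing \<open>P'\<close> by \<open>P\<close> then needs a Lipschitz property of \<open>f\<close>
  alone.
\<close>

lemma best_response_stability:
  assumes f: "strategy_profile f" and P: "belief i P" and t: "t \<in> T i"
    and x: "is_arg_max (\<lambda>x. \<integral>\<theta>. u i (join i x (play f \<theta>)) (join i t \<theta>) \<partial>P) (\<lambda>x. x \<in> A i) x"
    and f': "strategy_profile f'" and P': "belief i P'"
    and y: "is_arg_max (\<lambda>x. \<integral>\<theta>. u i (join i x (play f' \<theta>)) (join i t \<theta>) \<partial>P') (\<lambda>x. x \<in> A i) y"
    and Lip: "\<And>j s s'. j \<noteq> i \<Longrightarrow> s \<in> T j \<Longrightarrow> s' \<in> T j \<Longrightarrow> norm (f j s - f j s') \<le> k j / \<sigma> j * norm (s - s')"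
    and D: "\<And>j s. j \<noteq> i \<Longrightarrow> s \<in> T j \<Longrightarrow> norm (f' j s - f j s) \<le> D j"
    and \<tau>: "\<And>j. j \<noteq> i \<Longrightarrow> 0 \<le> \<tau> i j"
    and g_actions: "\<And>x a a' \<theta>. x \<in> A i \<Longrightarrow> a \<in> others A i \<Longrightarrow> a' \<in> others A i \<Longrightarrow> \<theta> \<in> profiles T \<Longrightarrow>
        norm (g i (join i x a) \<theta> - g i (join i x a') \<theta>) \<le> (\<Sum>j\<in>UNIV - {i}. \<tau> i j * norm (a $ j - a' $ j))"
    and g_types: "\<And>a \<theta> \<theta>'. a \<in> profiles A \<Longrightarrow> \<theta> \<in> others T i \<Longrightarrow> \<theta>' \<in> others T i \<Longrightarrow>
        norm (g i a (join i t \<theta>) - g i a (join i t \<theta>')) \<le> \<rho> * norm (\<theta> - \<theta>')"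
  shows "\<sigma> i * norm (y - x) \<le> (\<Sum>j\<in>UNIV - {i}. \<tau> i j * D j) + (tau_total \<sigma> \<tau> k i + \<rho>) * d_K P P'"
proof -
  interpret P': prob_space P' using P' by simp
  let ?d = "y - x" and ?L = "tau_total \<sigma> \<tau> k i + \<rho>" and ?E = "\<Sum>j\<in>UNIV - {i}. \<tau> i j * D j"
  have A: "x \<in> A i" "y \<in> A i" using x y by (auto simp: is_arg_max_def)
  have dp: "drop_player i (play h \<theta>) \<in> others A i" if "strategy_profile h" "\<theta> \<in> others T i" for h \<theta>
    using drop_play_in_others[where T=T and A=A] that by blast
  have actions: "norm (g i (join i x (play h \<theta>)) \<phi> - g i (join i x (play h' \<theta>')) \<phi>)
      \<le> (\<Sum>j\<in>UNIV - {i}. \<tau> i j * norm (h j (\<theta> $ j) - h' j (\<theta>' $ j)))"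
    if "strategy_profile h" "strategy_profile h'" "\<theta> \<in> others T i" "\<theta>' \<in> others T i" "\<phi> \<in> profiles T" for h h' \<theta> \<theta>' \<phi>
  proof -
    have "(\<Sum>j\<in>UNIV - {i}. \<tau> i j * norm (drop_player i (play h \<theta>) $ j - drop_player i (play h' \<theta>') $ j))
        = (\<Sum>j\<in>UNIV - {i}. \<tau> i j * norm (h j (\<theta> $ j) - h' j (\<theta>' $ j)))"
      by (rule sum.cong) (auto simp: drop_player_def play_nth)
    then show ?thesis
      using g_actions[OF A(1) dp[OF that(1,3)] dp[OF that(2,4)] that(5)] by (simp add: join_drop_player)
  qed
  have "(\<integral>\<theta>. marginal_utility g f' i t x \<theta> \<bullet> ?d \<partial>P')
      \<le> (\<integral>\<theta>. marginal_utility g f i t x \<theta> \<bullet> ?d + ?E * norm ?d \<partial>P')"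
  proof (rule integral_mono)
    fix \<theta> assume "\<theta> \<in> space P'"
    then have \<theta>: "\<theta> \<in> others T i" using belief_space[OF P'] by simp
    have "norm (marginal_utility g f' i t x \<theta> - marginal_utility g f i t x \<theta>) \<le> ?E"
      unfolding marginal_utility_def
      by (rule order_trans[OF actions[OF f' f \<theta> \<theta> join_in_profiles[where X=T, OF t \<theta>]] sum_mono])
        (use \<theta> in \<open>auto intro!: mult_left_mono D \<tau> simp: others_def\<close>)
    then have "(marginal_utility g f' i t x \<theta> - marginal_utility g f i t x \<theta>) \<bullet> ?d \<le> ?E * norm ?d"
      by (meson mult_right_mono norm_cauchy_schwarz norm_ge_zero order_trans)
    then show "marginal_utility g f' i t x \<theta> \<bullet> ?d \<le> marginal_utility g f i t x \<theta> \<bullet> ?d + ?E * norm ?d"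
      by (simp add: inner_diff_left)
  qed (use slope_integrable[OF f' P' A t] slope_integrable[OF f P' A t] in auto)
  also have "\<dots> = (\<integral>\<theta>. marginal_utility g f i t x \<theta> \<bullet> ?d \<partial>P') + ?E * norm ?d"
    using slope_integrable[OF f P' A t] by (simp add: P'.prob_space)
  finally have strategy_part: "(\<integral>\<theta>. marginal_utility g f' i t x \<theta> \<bullet> ?d \<partial>P')
      \<le> (\<integral>\<theta>. marginal_utility g f i t x \<theta> \<bullet> ?d \<partial>P') + ?E * norm ?d" .
  have Lip_g: "norm (marginal_utility g f i t x \<theta> - marginal_utility g f i t x \<theta>') \<le> ?L * dist \<theta> \<theta>'"
    if \<theta>: "\<theta> \<in> others T i" "\<theta>' \<in> others T i" for \<theta> \<theta>'
  proof -
    have "norm (marginal_utility g f i t x \<theta> - marginal_utility g f i t x \<theta>')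
        \<le> norm (g i (join i x (play f \<theta>)) (join i t \<theta>) - g i (join i x (play f \<theta>)) (join i t \<theta>'))
          + norm (g i (join i x (play f \<theta>)) (join i t \<theta>') - g i (join i x (play f \<theta>')) (join i t \<theta>'))"
      unfolding marginal_utility_def by (rule order_trans[OF _ norm_triangle_ineq]) simp
    also have "\<dots> \<le> \<rho> * norm (\<theta> - \<theta>') + tau_total \<sigma> \<tau> k i * norm (\<theta> - \<theta>')"
      using actions[OF f f \<theta> join_in_profiles[where X=T, OF t \<theta>(2)]]
        play_Lipschitz[where f=f and \<tau>=\<tau> and k=k, OF Lip \<tau> \<theta>]
      by (intro add_mono g_types join_play[OF f \<theta>(1) A(1)] \<theta>) auto
    finally show ?thesis by (simp add: algebra_simps dist_norm)
  qed
  note d_K_bound = integral_diff_le_d_K[where X="others T i" and P=P and Q=P']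
  have "\<bar>marginal_utility g f i t x \<theta> \<bullet> ?d - marginal_utility g f i t x \<theta>' \<bullet> ?d\<bar> \<le> (?L * norm ?d) * dist \<theta> \<theta>'"
    if "\<theta> \<in> others T i" "\<theta>' \<in> others T i" for \<theta> \<theta>'
    using mult_right_mono[OF Lip_g[OF that] norm_ge_zero[of ?d]]
      Cauchy_Schwarz_ineq2[of "marginal_utility g f i t x \<theta> - marginal_utility g f i t x \<theta>'" ?d]
    by (simp add: inner_diff_left mult.commute mult.left_commute)
  then have "\<bar>(\<integral>\<theta>. marginal_utility g f i t x \<theta> \<bullet> ?d \<partial>P) - (\<integral>\<theta>. marginal_utility g f i t x \<theta> \<bullet> ?d \<partial>P')\<bar>
      \<le> (?L * norm ?d) * d_K P P'"
    using P P' bounded_others[OF T_compact] by (intro d_K_bound) auto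
  then have "\<sigma> i * (norm ?d)\<^sup>2 \<le> ?E * norm ?d + (?L * norm ?d) * d_K P P'"
    using best_response_distance[OF f P t x f' P' t y] strategy_part by linarith
  then have main: "norm ?d * (\<sigma> i * norm ?d) \<le> norm ?d * (?E + ?L * d_K P P')"
    by (simp add: power2_eq_square algebra_simps)
  show ?thesis
  proof (cases "y = x")
    case True
    \<comment> \<open>Cancelling \<open>norm ?d\<close> is impossible here; the bound is nonnegative even if \<open>\<rho>\<close> is not.\<close>
    have "0 \<le> ?E"
    proof (intro sum_nonneg mult_nonneg_nonneg)
      fix j assume "j \<in> UNIV - {i}"
      then show "0 \<le> \<tau> i j" "0 \<le> D j"
        using \<tau> D T_nonempty[of j] norm_ge_zero order_trans by blast+
    qed
    moreover have "\<bar>(\<integral>\<theta>. 0 \<partial>P) - (\<integral>\<theta>. 0 \<partial>P')\<bar> \<le> ?L * d_K P P'"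
      using P P' bounded_others[OF T_compact] order_trans[OF norm_ge_zero Lip_g] by (intro d_K_bound) auto
    ultimately show ?thesis using True by simp
  qed (use main in simp)
qed

end

section \<open>The contraction constant\<close>

text \<open>
  The entry of $D^{-1} M D$ at $(i, j)$ is $\tau_{ij} w_j / (\sigma_i w_i)$, so the claim says that row
  \<open>i\<close> of this matrix sums to at most its infinity norm.
\<close>

lemma contraction_const_row:
  fixes w \<sigma> :: "'n::finite \<Rightarrow> real"
  assumes w: "\<And>i. 0 < w i" and \<sigma>: "0 < \<sigma> i" and \<tau>: "\<And>j. j \<noteq> i \<Longrightarrow> 0 \<le> \<tau> i j"
  shows "(\<Sum>j\<in>UNIV - {i}. \<tau> i j * w j) \<le> contraction_const \<sigma> \<tau> w * (\<sigma> i * w i)"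
proof -
  have left: "(diag_matrix v ** M) $ i $ j = v i * M $ i $ j" for v and M :: "real ^ 'n ^ 'n" and i j
    by (simp add: matrix_matrix_mult_def diag_matrix_def if_distrib[where f="\<lambda>x. x * _"] cong: if_cong)
  have right: "(M ** diag_matrix v) $ i $ j = M $ i $ j * v j" for v and M :: "real ^ 'n ^ 'n" and i j
    by (simp add: matrix_matrix_mult_def diag_matrix_def if_distrib[where f="\<lambda>x. _ * x"] cong: if_cong)
  have diag: "diag_matrix v ** diag_matrix v' = diag_matrix (\<lambda>i. v i * v' i)" for v v' :: "'n \<Rightarrow> real"
    by (simp add: vec_eq_iff left) (simp add: diag_matrix_def)
  have one: "diag_matrix (\<lambda>_. 1 :: real) = (mat 1 :: real ^ 'n ^ 'n)" by (simp add: diag_matrix_def mat_def)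
  have nz: "w i \<noteq> 0" for i using w[of i] by simp
  have inv: "matrix_inv (diag_matrix w) = diag_matrix (\<lambda>i. 1 / w i)"
  proof -
    have 1: "diag_matrix w ** diag_matrix (\<lambda>i. 1 / w i) = mat 1" "diag_matrix (\<lambda>i. 1 / w i) ** diag_matrix w = mat 1"
      by (simp_all add: diag nz one)
    then have "matrix_inv (diag_matrix w) ** diag_matrix w = mat 1"
      unfolding matrix_inv_def by (intro conjunct2[OF someI[where P="\<lambda>B. _ ** B = mat 1 \<and> B ** _ = mat 1"]]) simp
    then show ?thesis by (metis 1(1) matrix_mul_assoc matrix_mul_lid matrix_mul_rid)
  qed
  let ?B = "matrix_inv (diag_matrix w) ** interaction_matrix \<sigma> \<tau> ** diag_matrix w"
  have entry: "?B $ i $ j = interaction_matrix \<sigma> \<tau> $ i $ j * w j / w i" for j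
    by (simp add: inv left right)
  have "(\<Sum>j\<in>UNIV - {i}. \<tau> i j * w j) / (\<sigma> i * w i) = (\<Sum>j\<in>UNIV - {i}. \<bar>?B $ i $ j\<bar>)"
    unfolding entry sum_divide_distrib
    by (rule sum.cong) (use w \<sigma> \<tau> in \<open>auto simp: interaction_matrix_def abs_mult less_imp_le\<close>)
  also have "\<dots> \<le> (\<Sum>j\<in>UNIV. \<bar>?B $ i $ j\<bar>)" by (rule sum_mono2) auto
  also have "\<dots> \<le> contraction_const \<sigma> \<tau> w"
    unfolding contraction_const_def matrix_norm_inf_def by (rule Max_ge) auto
  finally show ?thesis using w[of i] \<sigma> by (simp add: pos_divide_le_eq)
qed

section \<open>Stability of equilibria\<close>

theorem theorem6p1:
  fixes T :: "'n::finite \<Rightarrow> 't::euclidean_space set"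
    and A :: "'n \<Rightarrow> 'a::euclidean_space set"
    and u :: "'n \<Rightarrow> 'a ^ 'n \<Rightarrow> 't ^ 'n \<Rightarrow> real"
    and g :: "'n \<Rightarrow> 'a ^ 'n \<Rightarrow> 't ^ 'n \<Rightarrow> 'a"
    and \<eta> \<mu> :: "('t ^ 'n) measure"
    and \<eta>c \<mu>c :: "'n \<Rightarrow> 't \<Rightarrow> ('t ^ 'n) measure"
    and \<sigma> \<gamma> \<rho> w :: "'n \<Rightarrow> real"
    and \<tau> :: "'n \<Rightarrow> 'n \<Rightarrow> real"
    and \<nu> :: "'n \<Rightarrow> 't ^ 'n \<Rightarrow> real"
    and f\<eta> f\<mu> :: "'n \<Rightarrow> 't \<Rightarrow> 'a"
    and \<alpha> :: real
  assumes "game_sets T A"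
    and "own_gradient T A u g"
    and "type_distribution T \<eta>" and "full_support T \<eta>" and "conditional_distribution T \<eta> \<eta>c"
    and "assumption_A T A u g \<eta>c"
    and "assumption_B T A g \<sigma> \<tau>"
    and "assumption_C T A g \<eta>c \<nu> \<gamma>"
    and "assumption_E T A g \<rho>"
    and "\<forall>i. 0 < w i"
    and "\<alpha> = contraction_const \<sigma> \<tau> w" and "\<alpha> < 1"
    and "admissible_distribution T \<mu> \<mu>c"
    and "BNE T A u \<eta>c f\<eta>" and "\<forall>i. continuous_on (T i) (f\<eta> i)"
    and "BNE T A u \<mu>c f\<mu>"
  shows "(MAX i \<in> UNIV. 1 / w i * (SUP t \<in> T i. norm (f\<eta> i t - f\<mu> i t)))
       \<le> (MAX i \<in> UNIV. SUP t \<in> T i.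
            (tau_total \<sigma> \<tau> (kappa T A g \<eta>c \<nu> \<gamma>) i + \<rho> i) / (w i * \<sigma> i * (1 - \<alpha>))
              * d_K (\<eta>c i t) (\<mu>c i t))"
proof -
  define C where "C i = (SUP (a, \<theta>) \<in> profiles A \<times> profiles T. norm (g i a \<theta>))" for i
  define k where "k = kappa T A g \<eta>c \<nu> \<gamma>"
  note A = \<open>assumption_A T A u g \<eta>c\<close>[unfolded assumption_A_def]
  note B = \<open>assumption_B T A g \<sigma> \<tau>\<close>[unfolded assumption_B_def]
  note C = \<open>assumption_C T A g \<eta>c \<nu> \<gamma>\<close>[unfolded assumption_C_def]
  interpret concave_game T A u g C \<sigma>
  proof
    fix i :: 'n and a \<theta> assume "a \<in> profiles A" "\<theta> \<in> profiles T"
    moreover have "bdd_above ((\<lambda>(a, \<theta>). norm (g i a \<theta>)) ` (profiles A \<times> profiles T))"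
      using C by simp
    ultimately show "norm (g i a \<theta>) \<le> C i" unfolding C_def by (intro cSUP_upper2[where x="(a, \<theta>)"]) auto
  qed (use assms(1,2) A B in auto)
  have w: "0 < w i" for i using assms(10) by blast
  have \<tau>: "0 \<le> \<tau> i j" if "j \<noteq> i" for i j using B that by blast
  have \<eta>: "belief i (\<eta>c i t)" and \<mu>: "belief i (\<mu>c i t)" if "t \<in> T i" for i t
    using assms(5,13) that unfolding admissible_distribution_def conditional_distribution_def by blast+
  have strat: "strategy_profile f\<eta>" "strategy_profile f\<mu>"
    using assms(14,16) unfolding BNE_def by blast+
  have opt: "is_arg_max (\<lambda>x. \<integral>\<theta>. u i (join i x (play f\<eta> \<theta>)) (join i t \<theta>) \<partial>\<eta>c i t) (\<lambda>x. x \<in> A i) (f\<eta> i t)"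
      "is_arg_max (\<lambda>x. \<integral>\<theta>. u i (join i x (play f\<mu> \<theta>)) (join i t \<theta>) \<partial>\<mu>c i t) (\<lambda>x. x \<in> A i) (f\<mu> i t)"
    if "t \<in> T i" for i t
    using assms(14,16) that unfolding BNE_def expected_utility_def by blast+
  have Lip: "norm (f\<eta> i s - f\<eta> i s') \<le> k i / \<sigma> i * norm (s - s')" if s: "s \<in> T i" "s' \<in> T i" for i s s'
  proof -
    let ?N = "nu_sup T \<eta>c \<nu> i" and ?I = "\<integral>\<^sup>+\<theta>. ennreal (\<nu> i \<theta>) \<partial>\<eta>c i s'"
    have le: "?I \<le> ?N" unfolding nu_sup_def by (rule SUP_upper) (rule s)
    have fin: "?N < \<infinity>" using C by blast
    have meas: "\<nu> i \<in> borel_measurable (\<eta>c i s')"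
      using C \<eta>[OF s(2)] measurable_cong_sets by blast
    have nonneg: "AE \<theta> in \<eta>c i s'. 0 \<le> \<nu> i \<theta>"
      using C belief_space[OF \<eta>[OF s(2)]] by auto
    have int: "integrable (\<eta>c i s') (\<nu> i)"
      using meas nonneg order.strict_trans1[OF le fin] by (rule integrableI_nonneg)
    have "(\<integral>\<theta>. \<nu> i \<theta> \<partial>\<eta>c i s') = enn2real ?I"
      using meas nonneg by (rule integral_eq_nn_integral)
    also have "\<dots> \<le> enn2real ?N" using le fin by (intro enn2real_mono) auto
    finally have N: "(\<integral>\<theta>. \<nu> i \<theta> \<partial>\<eta>c i s') \<le> enn2real ?N" .
    have TV: "d_TV (\<eta>c i s') (\<eta>c i s) \<le> \<gamma> i * norm (s - s')" using C s by (metis norm_minus_commute)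
    have "norm (f\<eta> i s - f\<eta> i s') \<le> (enn2real ?N + 2 * \<gamma> i * C i) / \<sigma> i * norm (s - s')"
      using C s by (intro equilibrium_type_Lipschitz[OF strat(1) \<eta>[OF s(2)] s(2) opt(1)[OF s(2)] \<eta>[OF s(1)] s(1)
          opt(1)[OF s(1)] _ int N _ TV]) (auto simp: less_imp_le)
    then show ?thesis by (simp add: k_def kappa_def C_def)
  qed
  define D where "D i = (SUP t \<in> T i. norm (f\<eta> i t - f\<mu> i t))" for i
  have bdd: "bdd_above ((\<lambda>t. norm (f\<eta> i t - f\<mu> i t)) ` T i)" for i
  proof -
    obtain b where "\<And>v. v \<in> A i \<Longrightarrow> norm v \<le> b"
      using compact_imp_bounded[OF A_compact[of i]] by (auto simp: bounded_iff)
    then have "norm (f\<eta> i t - f\<mu> i t) \<le> b + b" if "t \<in> T i" for t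
      using space_strategies[OF strat(1)[rule_format] that] space_strategies[OF strat(2)[rule_format] that]
        norm_triangle_ineq4[of "f\<eta> i t" "f\<mu> i t"] by (meson add_mono order_trans)
    then show ?thesis by (rule bdd_aboveI2)
  qed
  have D: "norm (f\<eta> i t - f\<mu> i t) \<le> D i" if "t \<in> T i" for i t
    unfolding D_def using bdd that by (rule cSUP_upper2) simp
  have D_nonneg: "0 \<le> D i" for i
    using T_nonempty[of i] D norm_ge_zero order_trans by blast
  have step: "\<sigma> i * norm (f\<eta> i t - f\<mu> i t)
      \<le> (\<Sum>j\<in>UNIV - {i}. \<tau> i j * D j) + (tau_total \<sigma> \<tau> k i + \<rho> i) * d_K (\<eta>c i t) (\<mu>c i t)"
    if t: "t \<in> T i" for i t
  proof -
    have "\<sigma> i * norm (f\<mu> i t - f\<eta> i t)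
      \<le> (\<Sum>j\<in>UNIV - {i}. \<tau> i j * D j) + (tau_total \<sigma> \<tau> k i + \<rho> i) * d_K (\<eta>c i t) (\<mu>c i t)"
    proof (rule best_response_stability[OF strat(1) \<eta>[OF t] t opt(1)[OF t] strat(2) \<mu>[OF t] opt(2)[OF t]])
      show "norm (f\<mu> j s - f\<eta> j s) \<le> D j" if "s \<in> T j" for j s using D[OF that] by (simp add: norm_minus_commute)
    qed (use Lip \<tau> B \<open>assumption_E T A g \<rho>\<close> t in \<open>simp_all add: assumption_E_def\<close>)
    then show ?thesis by (simp add: norm_minus_commute)
  qed
  define m where "m = (MAX i \<in> UNIV. 1 / w i * D i)"
  have D_le: "D i \<le> m * w i" for i
  proof -
    have "1 / w i * D i \<le> m" unfolding m_def by (rule Max_ge) auto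
    then show ?thesis using w[of i] by (simp add: field_simps)
  qed
  have m_nonneg: "0 \<le> m"
    using D_le D_nonneg w by (metis less_le_not_le mult_neg_pos not_less order_trans)
  let ?c = "\<lambda>i. (tau_total \<sigma> \<tau> k i + \<rho> i) / (w i * \<sigma> i * (1 - \<alpha>))"
  define R where "R = (MAX i \<in> UNIV. SUP t \<in> T i. ?c i * d_K (\<eta>c i t) (\<mu>c i t))"
  have R: "?c i * d_K (\<eta>c i t) (\<mu>c i t) \<le> R" if t: "t \<in> T i" for i t
  proof -
    have "bdd_above ((\<lambda>t. ?c i * d_K (\<eta>c i t) (\<mu>c i t)) ` T i)"
    proof (rule bdd_aboveI2)
      fix s assume s: "s \<in> T i"
      have "0 \<le> d_K (\<eta>c i s) (\<mu>c i s)" "d_K (\<eta>c i s) (\<mu>c i s) \<le> 2 * diameter (others T i)"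
        using d_K_nonneg[of _ "others T i"] d_K_le[of _ "others T i"] \<eta>[OF s] \<mu>[OF s]
          bounded_others[where X=T and i=i, OF T_compact] by blast+
      then show "?c i * d_K (\<eta>c i s) (\<mu>c i s) \<le> \<bar>?c i\<bar> * (2 * diameter (others T i))"
        by (intro mult_mono abs_ge_self abs_ge_zero)
    qed
    then have "?c i * d_K (\<eta>c i t) (\<mu>c i t) \<le> (SUP t \<in> T i. ?c i * d_K (\<eta>c i t) (\<mu>c i t))"
      using t by (intro cSUP_upper)
    also have "\<dots> \<le> R" unfolding R_def by (rule Max_ge) auto
    finally show ?thesis .
  qed
  have "1 / w i * D i \<le> \<alpha> * m + (1 - \<alpha>) * R" for i
  proof -
    have pos: "0 < w i * \<sigma> i" "0 < 1 - \<alpha>" using w[of i] sigma_pos[of i] assms(12) by simp_all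
    have "(\<Sum>j\<in>UNIV - {i}. \<tau> i j * D j) \<le> (\<Sum>j\<in>UNIV - {i}. \<tau> i j * (m * w j))"
      by (intro sum_mono mult_left_mono D_le \<tau>) auto
    also have "\<dots> = m * (\<Sum>j\<in>UNIV - {i}. \<tau> i j * w j)" by (simp add: sum_distrib_left mult_ac)
    also have "\<dots> \<le> m * (\<alpha> * (\<sigma> i * w i))"
      unfolding assms(11) by (intro mult_left_mono contraction_const_row w sigma_pos \<tau> m_nonneg) auto
    finally have row: "(\<Sum>j\<in>UNIV - {i}. \<tau> i j * D j) \<le> m * (\<alpha> * (\<sigma> i * w i))" .
    have "norm (f\<eta> i t - f\<mu> i t) \<le> w i * (\<alpha> * m + (1 - \<alpha>) * R)" if t: "t \<in> T i" for t
    proof -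
      have "(tau_total \<sigma> \<tau> k i + \<rho> i) * d_K (\<eta>c i t) (\<mu>c i t)
          = (w i * \<sigma> i * (1 - \<alpha>)) * (?c i * d_K (\<eta>c i t) (\<mu>c i t))"
        using pos w[of i] sigma_pos[of i] by simp
      also have "\<dots> \<le> (w i * \<sigma> i * (1 - \<alpha>)) * R"
        using R[OF t] pos by (intro mult_left_mono) auto
      finally have "\<sigma> i * norm (f\<eta> i t - f\<mu> i t) \<le> m * (\<alpha> * (\<sigma> i * w i)) + (w i * \<sigma> i * (1 - \<alpha>)) * R"
        using step[OF t] row by linarith
      also have "\<dots> = \<sigma> i * (w i * (\<alpha> * m + (1 - \<alpha>) * R))" by (simp add: algebra_simps)
      finally show ?thesis using sigma_pos[of i] by simp
    qed
    then have "D i \<le> w i * (\<alpha> * m + (1 - \<alpha>) * R)"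
      unfolding D_def using T_nonempty by (intro cSUP_least)
    then show ?thesis using w[of i] by (simp add: field_simps)
  qed
  then have "m \<le> \<alpha> * m + (1 - \<alpha>) * R" unfolding m_def by (subst Max_le_iff) (auto simp del: Max_le_iff)
  then have "(1 - \<alpha>) * m \<le> (1 - \<alpha>) * R" by (simp add: algebra_simps)
  then have "m \<le> R" using assms(12) by simp
  then show ?thesis by (simp add: m_def R_def D_def k_def)
qed

end
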